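(* Let $T>0$, $\tau\in(0,T)$, $s\in(1,2)$ and $0<R'<\tau$ with $R'\le T-\tau$. For $\theta_0\in L^2(0,1)$ and $\overline{i},\overline{k},\overline{n}\in\mathbb{N}$, let $\theta$ and $\overline{\theta}$ (on $[\tau,T]\times[0,1]$) be the infinite series and the truncated series associated with $\theta_0$ as defined in the context. Then there exist positive constants $C,C_1,C_2,C_3$ such that for all $\theta_0\in L^2(0,1)$, all $\overline{i},\overline{k},\overline{n}\in\mathbb{N}$, and all $t\in[\tau,T]$, $$\|\theta(t,\cdot)-\overline{\theta}(t,\cdot)\|_{L^\infty(0,1)}\le C\left(e^{-C_1\,\overline{i}\ln\overline{i}}+e^{-C_2\,\overline{k}}+e^{-C_3\,\overline{n}^2}\right)\|\theta_0\|_{L^2(0,1)}.$$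
   Context: Step function: for $s>1$ and $\kappa=(s-1)^{-1}$, $\phi_s(t)=1$ if $t\le0$, $\phi_s(t)=0$ if $t\ge1$, and $\phi_s(t)=\dfrac{e^{-(1-t)^{-\kappa}}}{e^{-(1-t)^{-\kappa}}+e^{-t^{-\kappa}}}$ if $0<t<1$. Write $\theta_0\in L^2(0,1)$ as its cosine Fourier series $\theta_0(x)=\sum_{n\ge0}c_n\sqrt2\cos(n\pi x)$ (convergence in $L^2(0,1)$), so that $2|c_0|^2+\sum_{n\ge1}|c_n|^2=\int_0^1|\theta_0(x)|^2dx$. Infinite series: for $k\ge0$, $y_k=\sqrt2\Bigl(\sum_{n\ge0}c_ne^{-n^2\pi^2\tau}n^{2k}\Bigr)(-\pi^2)^k$; for $t\in[\tau,\tau+R']$, $y(t)=\phi_s\bigl(\frac{t-\tau}{R'}\bigr)\sum_{k\ge0}y_k\frac{(t-\tau)^k}{k!}$, and $y(t)=0$ for $t\in[\tau+R',T]$; and $\theta(t,x)=\sum_{i\ge0}y^{(i)}(t)\frac{x^{2i}}{(2i)!}$ for $(t,x)\in[\tau,T]\times[0,1]$. Truncated series: $\overline{y_k}=\sqrt2\Bigl(\sum_{0\le n\le\overline{n}}c_ne^{-n^2\pi^2\tau}n^{2k}\Bigr)(-\pi^2)^k$; $\overline{y}(t)=\phi_s\bigl(\frac{t-\tau}{R'}\bigr)\sum_{0\le k\le\overline{k}}\overline{y_k}\frac{(t-\tau)^k}{k!}$ for $t\in[\tau,T]$; and $\overline{\theta}(t,x)=\sum_{0\le i\le\overline{i}}\overline{y}^{(i)}(t)\frac{x^{2i}}{(2i)!}$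 for $(t,x)\in[\tau,T]\times[0,1]$. Conventions: $0^0=1$ and $0\ln0=0$. The constants $C,C_1,C_2,C_3$ may depend on $T,\tau,s,R'$. *)

theory Defs
  imports "HOL-Analysis.Analysis" "HOL-Probability.Essential_Supremum"
begin

abbreviation M01 :: "real measure" where
  "M01 \<equiv> lebesgue_on {0<..<1}"

definition L2_01 :: "(real \<Rightarrow> complex) set" where
  "L2_01 = {f. f \<in> borel_measurable M01 \<and> integrable M01 (\<lambda>x. (norm (f x))\<^sup>2)}"

definition norm_L2_01 :: "(real \<Rightarrow> complex) \<Rightarrow> real" where
  "norm_L2_01 f = sqrt (LINT x|M01. (norm (f x))\<^sup>2)"

text \<open>Extended-real valued; equal to \<open>\<infinity>\<close> if the norm of \<open>f\<close> is not measurable.\<close>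

definition norm_Linf_01 :: "(real \<Rightarrow> complex) \<Rightarrow> ereal" where
  "norm_Linf_01 f = esssup M01 (\<lambda>x. ereal (norm (f x)))"

definition step_fun :: "real \<Rightarrow> real \<Rightarrow> real" where
  "step_fun s t =
     (let \<kappa> = 1 / (s - 1) in
      if t \<le> 0 then 1 else if t \<ge> 1 then 0
      else exp (- ((1 - t) powr (-\<kappa>))) /
             (exp (- ((1 - t) powr (-\<kappa>))) + exp (- (t powr (-\<kappa>)))))"

text \<open>
  The Fourier coefficients \<open>c n\<close> of \<open>f\<close> in the cosine expansion
  \<open>f x = (\<Sum>n. c n * sqrt 2 * cos (n * pi * x))\<close>, convergent in $L^2(0,1)$.
  The basis function with \<open>n = 0\<close> is the constant \<open>sqrt 2\<close>, of squared norm 2, while all the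
  others have norm 1; hence the different factor for \<open>n = 0\<close>, and the Parseval identity
  \<open>2 |c 0|\<^sup>2 + (\<Sum>n\<ge>1. |c n|\<^sup>2) = \<parallel>f\<parallel>\<^sup>2\<close>.
  By the lemma \<open>cos_coeff_unique\<close> below, these are the only possible coefficients of
  such an expansion.
\<close>

definition cos_coeff :: "(real \<Rightarrow> complex) \<Rightarrow> nat \<Rightarrow> complex" where
  "cos_coeff f n =
     (if n = 0 then 1 / sqrt 2 else sqrt 2) *\<^sub>R (LINT x|M01. cos (real n * pi * x) *\<^sub>R f x)"

text \<open>
  Iterated derivative of a function on a set \<open>S\<close>: only values on \<open>S\<close> matter, and derivatives at
  the end points of an interval are one-sided.
\<close>

fun nth_deriv_on :: "real set \<Rightarrow> nat \<Rightarrow> (real \<Rightarrow> complex) \<Rightarrow> real \<Rightarrow> complex" where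
  "nth_deriv_on S 0 f = f"
| "nth_deriv_on S (Suc n) f = (\<lambda>t. vector_derivative (nth_deriv_on S n f) (at t within S))"


subsection \<open>The infinite series\<close>

definition y_coeff :: "real \<Rightarrow> (real \<Rightarrow> complex) \<Rightarrow> nat \<Rightarrow> complex" where
  "y_coeff \<tau> \<theta>\<^sub>0 k =
     (sqrt 2 * (- (pi\<^sup>2)) ^ k) *\<^sub>R
       (\<Sum>n. (exp (- ((real n)\<^sup>2 * pi\<^sup>2 * \<tau>)) * real n ^ (2 * k)) *\<^sub>R cos_coeff \<theta>\<^sub>0 n)"

definition flat_output :: "real \<Rightarrow> real \<Rightarrow> real \<Rightarrow> (real \<Rightarrow> complex) \<Rightarrow> real \<Rightarrow> complex" where
  "flat_output \<tau> s R' \<theta>\<^sub>0 t =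
     (if t \<le> \<tau> + R'
      then step_fun s ((t - \<tau>) / R') *\<^sub>R (\<Sum>k. ((t - \<tau>) ^ k / fact k) *\<^sub>R y_coeff \<tau> \<theta>\<^sub>0 k)
      else 0)"

definition theta ::
  "real \<Rightarrow> real \<Rightarrow> real \<Rightarrow> real \<Rightarrow> (real \<Rightarrow> complex) \<Rightarrow> real \<Rightarrow> real \<Rightarrow> complex" where
  "theta T \<tau> s R' \<theta>\<^sub>0 t x =
     (\<Sum>i. (x ^ (2 * i) / fact (2 * i)) *\<^sub>R nth_deriv_on {\<tau>..T} i (flat_output \<tau> s R' \<theta>\<^sub>0) t)"


subsection \<open>The truncated series\<close>

definition y_coeff_trunc :: "real \<Rightarrow> nat \<Rightarrow> (real \<Rightarrow> complex) \<Rightarrow> nat \<Rightarrow> complex" where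
  "y_coeff_trunc \<tau> nb \<theta>\<^sub>0 k =
     (sqrt 2 * (- (pi\<^sup>2)) ^ k) *\<^sub>R
       (\<Sum>n\<le>nb. (exp (- ((real n)\<^sup>2 * pi\<^sup>2 * \<tau>)) * real n ^ (2 * k)) *\<^sub>R cos_coeff \<theta>\<^sub>0 n)"

definition flat_output_trunc ::
  "real \<Rightarrow> real \<Rightarrow> real \<Rightarrow> nat \<Rightarrow> nat \<Rightarrow> (real \<Rightarrow> complex) \<Rightarrow> real \<Rightarrow> complex" where
  "flat_output_trunc \<tau> s R' kb nb \<theta>\<^sub>0 t =
     step_fun s ((t - \<tau>) / R') *\<^sub>R
       (\<Sum>k\<le>kb. ((t - \<tau>) ^ k / fact k) *\<^sub>R y_coeff_trunc \<tau> nb \<theta>\<^sub>0 k)"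

definition theta_trunc ::
  "real \<Rightarrow> real \<Rightarrow> real \<Rightarrow> real \<Rightarrow> nat \<Rightarrow> nat \<Rightarrow> nat \<Rightarrow> (real \<Rightarrow> complex) \<Rightarrow> real \<Rightarrow> real \<Rightarrow> complex" where
  "theta_trunc T \<tau> s R' ib kb nb \<theta>\<^sub>0 t x =
     (\<Sum>i\<le>ib. (x ^ (2 * i) / fact (2 * i)) *\<^sub>R
        nth_deriv_on {\<tau>..T} i (flat_output_trunc \<tau> s R' kb nb \<theta>\<^sub>0) t)"


subsection \<open>Uniqueness of the cosine coefficients\<close>

lemma finite_measure_M01: "finite_measure M01"
  by (rule finite_measure_lebesgue_on) (auto simp: lmeasurable_iff_integrable)

lemma measure_M01: "measure M01 (space M01) = 1"
  by (simp add: measure_restrict_space space_restrict_space)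

lemma integrable_M01_cont:
  fixes f :: "real \<Rightarrow> 'a::euclidean_space"
  assumes "continuous_on UNIV f"
  shows "integrable M01 f"
proof -
  have "f absolutely_integrable_on {0..1}"
    by (rule absolutely_integrable_continuous_real) (rule continuous_on_subset[OF assms], simp)
  then have "f absolutely_integrable_on {0<..<1}"
    by (rule set_integrable_subset) auto
  then show ?thesis
    by (simp add: integrable_restrict_space set_integrable_def)
qed

lemma integral_M01_cos:
  fixes k :: int
  shows "(LINT x|M01. cos (of_int k * pi * x)) = (if k = 0 then 1 else 0)"
proof -
  have "((\<lambda>x. cos (of_int k * pi * x)) has_integral (if k = 0 then 1 else 0)) {0..1}"
  proof (cases "k = 0")
    case True
    then show ?thesis
      using has_integral_const_real[of "1::real" 0 1] by simp
  next
    case False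
    have "((\<lambda>x. cos (of_int k * pi * x)) has_integral
            sin (of_int k * pi * 1) / (of_int k * pi) - sin (of_int k * pi * 0) / (of_int k * pi)) {0..1}"
      using False
      by (intro fundamental_theorem_of_calculus)
         (auto simp flip: has_real_derivative_iff_has_vector_derivative
               intro!: derivative_eq_intros)
    moreover have "sin (of_int k * pi) = 0"
      using sin_zero_iff_int2 by blast
    ultimately show ?thesis
      using False by simp
  qed
  then have "((\<lambda>x. cos (of_int k * pi * x)) has_integral (if k = 0 then 1 else 0)) {0<..<1}"
    by (simp add: has_integral_Icc_iff_Ioo)
  moreover have "integrable M01 (\<lambda>x. cos (of_int k * pi * x))"
    by (intro integrable_M01_cont continuous_intros)
  ultimately show ?thesis
    using lebesgue_integral_eq_integral[of "{0<..<1}" "\<lambda>x. cos (of_int k * pi * x)"]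
    by (simp add: integral_unique)
qed

lemma cos_orthogonal:
  "(LINT x|M01. cos (real m * pi * x) * cos (real n * pi * x)) =
     (if m = n then if m = 0 then 1 else 1 / 2 else 0)"
proof -
  have I: "integrable M01 (\<lambda>x. cos (of_int k * pi * x))" for k :: int
    by (intro integrable_M01_cont continuous_intros)
  have "cos (real m * pi * x) * cos (real n * pi * x) =
      (cos (of_int (int m - int n) * pi * x) + cos (of_int (int m + int n) * pi * x)) / 2" for x
    by (simp add: cos_times_cos algebra_simps)
  then have "(LINT x|M01. cos (real m * pi * x) * cos (real n * pi * x)) =
     (LINT x|M01. (cos (of_int (int m - int n) * pi * x) + cos (of_int (int m + int n) * pi * x)) / 2)"
    by presburger
  also have "\<dots> = ((LINT x|M01. cos (of_int (int m - int n) * pi * x)) +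
      (LINT x|M01. cos (of_int (int m + int n) * pi * x))) / 2"
    using I[of "int m - int n"] I[of "int m + int n"]
    by (simp del: of_int_diff of_int_add)
  also have "\<dots> = (if m = n then if m = 0 then 1 else 1 / 2 else 0)"
    unfolding integral_M01_cos by auto
  finally show ?thesis .
qed

lemma cos_coeff_cos_sum:
  assumes "m \<le> N"
  shows "cos_coeff (\<lambda>x. \<Sum>n\<le>N. (sqrt 2 * cos (real n * pi * x)) *\<^sub>R c n) m = c m"
proof -
  have I: "integrable M01 (\<lambda>x. cos (real m * pi * x) * cos (real n * pi * x))" for n
    by (intro integrable_M01_cont continuous_intros)
  have "(LINT x|M01. cos (real m * pi * x) *\<^sub>R (\<Sum>n\<le>N. (sqrt 2 * cos (real n * pi * x)) *\<^sub>R c n))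
      = (LINT x|M01. (\<Sum>n\<le>N. (cos (real m * pi * x) * cos (real n * pi * x)) *\<^sub>R (sqrt 2 *\<^sub>R c n)))"
    by (simp add: scaleR_sum_right algebra_simps)
  also have "\<dots> = (\<Sum>n\<le>N. (LINT x|M01. cos (real m * pi * x) * cos (real n * pi * x)) *\<^sub>R (sqrt 2 *\<^sub>R c n))"
    using I by (subst Bochner_Integration.integral_sum) (auto intro!: integrable_scaleR_left)
  also have "\<dots> = (\<Sum>n\<le>N. if m = n then (if m = 0 then sqrt 2 else sqrt 2 / 2) *\<^sub>R c n else 0)"
    by (intro sum.cong) (auto simp: cos_orthogonal)
  also have "\<dots> = (if m = 0 then sqrt 2 else sqrt 2 / 2) *\<^sub>R c m"
    using assms by simp
  finally show ?thesis
    by (auto simp: cos_coeff_def)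
qed

lemma L2_01_bound:
  assumes "f \<in> L2_01" "\<epsilon> > 0"
  shows "integrable M01 f" "(LINT x|M01. norm (f x)) \<le> \<epsilon> / 2 + (norm_L2_01 f)\<^sup>2 / (2 * \<epsilon>)"
proof -
  interpret finite_measure M01 by (rule finite_measure_M01)
  have m: "f \<in> borel_measurable M01" and i: "integrable M01 (\<lambda>x. (norm (f x))\<^sup>2)"
    using assms by (auto simp: L2_01_def)
  have ineq: "norm (f x) \<le> e / 2 + (norm (f x))\<^sup>2 / (2 * e)" if "e > 0" for x e
  proof -
    have "0 \<le> (norm (f x) - e)\<^sup>2" by simp
    then have "2 * e * norm (f x) \<le> e\<^sup>2 + (norm (f x))\<^sup>2"
      unfolding power2_diff by (simp add: mult_ac)
    then show ?thesis
      using that by (simp add: field_simps power2_eq_square)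
  qed
  have i2: "integrable M01 (\<lambda>x. e / 2 + (norm (f x))\<^sup>2 / (2 * e))" for e
    using i by simp
  show int: "integrable M01 f"
  proof (rule Bochner_Integration.integrable_bound[OF i2[of 1] m], rule AE_I2)
    fix x
    show "norm (f x) \<le> norm (1 / 2 + (norm (f x))\<^sup>2 / (2 * 1) :: real)"
      using ineq[of 1 x] by simp
  qed
  have "(LINT x|M01. norm (f x)) \<le> (LINT x|M01. \<epsilon> / 2 + (norm (f x))\<^sup>2 / (2 * \<epsilon>))"
    using int ineq[OF assms(2)] i2 by (intro integral_mono) auto
  also have "\<dots> = \<epsilon> / 2 + (norm_L2_01 f)\<^sup>2 / (2 * \<epsilon>)"
    using i measure_M01 by (simp add: norm_L2_01_def)
  finally show "(LINT x|M01. norm (f x)) \<le> \<epsilon> / 2 + (norm_L2_01 f)\<^sup>2 / (2 * \<epsilon>)" .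
qed

lemma cos_coeff_unique:
  assumes f: "f \<in> L2_01"
    and lim: "(\<lambda>N. norm_L2_01 (\<lambda>x. f x - (\<Sum>n\<le>N. (sqrt 2 * cos (real n * pi * x)) *\<^sub>R c n))) \<longlonglongrightarrow> 0"
  shows "c = cos_coeff f"
proof
  fix m
  define S where "S = (\<lambda>N x. \<Sum>n\<le>N. (sqrt 2 * cos (real n * pi * x)) *\<^sub>R c n)"
  define g where "g = (\<lambda>N x. f x - S N x)"
  have lim': "(\<lambda>N. norm_L2_01 (g N)) \<longlonglongrightarrow> 0"
    using lim by (simp add: g_def S_def)
  have fm: "f \<in> borel_measurable M01" and f2: "integrable M01 (\<lambda>x. (norm (f x))\<^sup>2)"
    using f by (auto simp: L2_01_def)
  have Sint: "integrable M01 (S N)" for N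
    unfolding S_def by (intro integrable_M01_cont continuous_intros)
  have S2: "integrable M01 (\<lambda>x. (norm (S N x))\<^sup>2)" for N
    unfolding S_def by (intro integrable_M01_cont continuous_intros)
  have gL2: "g N \<in> L2_01" for N
  proof -
    have gm: "g N \<in> borel_measurable M01"
      unfolding g_def using fm borel_measurable_integrable[OF Sint] by measurable
    have b: "(norm (g N x))\<^sup>2 \<le> 2 * (norm (f x))\<^sup>2 + 2 * (norm (S N x))\<^sup>2" for x
    proof -
      have "(norm (g N x))\<^sup>2 \<le> (norm (f x) + norm (S N x))\<^sup>2"
        unfolding g_def by (intro power_mono norm_triangle_ineq4) auto
      also have "\<dots> \<le> 2 * (norm (f x))\<^sup>2 + 2 * (norm (S N x))\<^sup>2"
        using zero_le_power2[of "norm (f x) - norm (S N x)"]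
        by (simp add: power2_diff power2_sum)
      finally show ?thesis .
    qed
    have "integrable M01 (\<lambda>x. (norm (g N x))\<^sup>2)"
      by (rule Bochner_Integration.integrable_bound
            [where f = "\<lambda>x. 2 * (norm (f x))\<^sup>2 + 2 * (norm (S N x))\<^sup>2"])
         (use f2 S2 gm b in auto)
    then show ?thesis
      using gm by (simp add: L2_01_def)
  qed
  have cosint: "integrable M01 (\<lambda>x. cos (real m * pi * x) *\<^sub>R h x)" if "integrable M01 h"
    for h :: "real \<Rightarrow> complex"
  proof (rule Bochner_Integration.integrable_bound[OF that])
    have "(\<lambda>x. cos (real m * pi * x)) \<in> borel_measurable M01"
      by (intro borel_measurable_integrable integrable_M01_cont continuous_intros)
    then show "(\<lambda>x. cos (real m * pi * x) *\<^sub>R h x) \<in> borel_measurable M01"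
      using borel_measurable_integrable[OF that] by measurable
    show "AE x in M01. norm (cos (real m * pi * x) *\<^sub>R h x) \<le> norm (h x)"
      by (intro AE_I2) (simp add: mult_left_le_one_le)
  qed
  have bound: "norm (cos_coeff f m - c m) \<le> 2 * \<epsilon>" if e: "\<epsilon> > 0" for \<epsilon>
  proof -
    have "\<forall>\<^sub>F N in sequentially. norm_L2_01 (g N) < \<epsilon>"
      using order_tendstoD(2)[OF lim' e] .
    then have "\<forall>\<^sub>F N in sequentially. norm_L2_01 (g N) < \<epsilon> \<and> m \<le> N"
      using eventually_ge_at_top by (rule eventually_conj)
    then obtain N where N: "norm_L2_01 (g N) < \<epsilon>" "m \<le> N"
      by (auto simp: eventually_sequentially)
    let ?a = "if m = 0 then 1 / sqrt 2 else sqrt 2"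
    have gi: "integrable M01 (g N)"
      using L2_01_bound(1)[OF gL2 e] .
    have fi: "integrable M01 f"
      using L2_01_bound(1)[OF f e] .
    have nn: "norm_L2_01 (g N) \<ge> 0"
      by (simp add: norm_L2_01_def)
    have "cos_coeff f m - c m = cos_coeff f m - cos_coeff (S N) m"
      using cos_coeff_cos_sum[OF N(2), of c] by (simp add: S_def)
    also have "\<dots> = cos_coeff (g N) m"
      using cosint[OF fi] cosint[OF Sint[of N]]
      by (simp add: cos_coeff_def g_def scaleR_diff_right)
    finally have "norm (cos_coeff f m - c m) =
        ?a * norm (LINT x|M01. cos (real m * pi * x) *\<^sub>R g N x)"
      by (simp add: cos_coeff_def)
    also have "\<dots> \<le> 2 * (LINT x|M01. norm (g N x))"
    proof (intro mult_mono)
      show "?a \<le> 2"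
        using sqrt2_less_2 by (auto simp: divide_le_eq intro: order_trans[of 1 "sqrt 2"])
      have "norm (LINT x|M01. cos (real m * pi * x) *\<^sub>R g N x)
          \<le> (LINT x|M01. norm (cos (real m * pi * x) *\<^sub>R g N x))"
        by (rule integral_norm_bound)
      also have "\<dots> \<le> (LINT x|M01. norm (g N x))"
        using integrable_norm[OF cosint[OF gi]] integrable_norm[OF gi]
        by (rule integral_mono) (simp add: mult_left_le_one_le)
      finally show "norm (LINT x|M01. cos (real m * pi * x) *\<^sub>R g N x) \<le> (LINT x|M01. norm (g N x))" .
    qed auto
    also have "\<dots> \<le> 2 * (\<epsilon> / 2 + (norm_L2_01 (g N))\<^sup>2 / (2 * \<epsilon>))"
      using L2_01_bound(2)[OF gL2 e] by (intro mult_left_mono) auto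
    also have "\<dots> \<le> 2 * (\<epsilon> / 2 + \<epsilon>\<^sup>2 / (2 * \<epsilon>))"
      using N nn e by (intro mult_left_mono add_mono divide_right_mono power_mono) auto
    also have "\<dots> = 2 * \<epsilon>"
      using e by (simp add: power2_eq_square)
    finally show ?thesis .
  qed
  have "norm (cos_coeff f m - c m) \<le> 0"
  proof (rule field_le_epsilon)
    fix e :: real
    assume "0 < e"
    then show "norm (cos_coeff f m - c m) \<le> 0 + e"
      using bound[of "e / 2"] by simp
  qed
  then show "c m = cos_coeff f m"
    by simp
qed

end

theory Submission
  imports Defs "HOL-Complex_Analysis.Cauchy_Integral_Formula"
begin

text \<open>
  On \<open>[\<tau>, \<tau> + R']\<close> the flat output is the product of the rescaled step function and the power
  series \<open>E u = (\<Sum>k. y\<^sub>k / k! * u ^ k)\<close> in \<open>u = t - \<tau>\<close>, and beyond \<open>\<tau> + R'\<close> it vanishes. Everything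
  rests on the sizes of the derivatives of the two factors.

  \<^item> The step function is Gevrey of order \<open>s\<close>: its \<open>m\<close>-th derivative is at most
    \<open>A * M ^ m * m! powr s\<close>. It extends holomorphically to discs around \<open>t \<in> (0,1)\<close> whose radius is
    proportional to the distance \<open>d\<close> from \<open>t\<close> to \<open>{0, 1}\<close>, and on such a disc it differs from its
    value at the near end by at most \<open>B * exp (- (d powr - \<kappa>) / 2)\<close>, where \<open>\<kappa> = 1 / (s - 1)\<close>. Cauchy's
    inequality costs a factor \<open>m! / (\<delta> * d) ^ m\<close>; the exponential absorbs \<open>d ^ - m\<close> at the price of
    \<open>m! powr (1 / \<kappa>) = m! powr (s - 1)\<close>. The same decay makes all derivatives vanish at 0 and 1
    (\<open>step_deriv_gevrey\<close>, \<open>has_vector_derivative_step_deriv\<close>).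

  \<^item> Since \<open>(n\<^sup>2 * pi\<^sup>2 * \<rho>) ^ k \<le> k! * exp (n\<^sup>2 * pi\<^sup>2 * \<rho>)\<close>, the heat factor \<open>exp (- n\<^sup>2 * pi\<^sup>2 * \<tau>)\<close> gives
    \<open>|y\<^sub>k| / k! \<le> A * \<parallel>\<theta>\<^sub>0\<parallel> / \<rho> ^ k\<close> for every \<open>\<rho> < \<tau>\<close>, so that the power series converges beyond \<open>R'\<close>;
    the part of \<open>y\<^sub>k\<close> that stems from the modes \<open>n > N\<close> is smaller by a further factor
    \<open>exp (- \<beta> * N\<^sup>2)\<close> (\<open>y_coeff_bounds\<close>). Dropping the terms \<open>k > K\<close> as well costs, in a slightly larger geometric
    majorant \<open>1 / r ^ k\<close> with \<open>R' < r < \<rho>\<close>, a factor \<open>(r / \<rho>) ^ K\<close>.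

  By Leibniz' rule, a coefficient sequence majorised by \<open>D / r ^ k\<close> yields a function whose \<open>i\<close>-th
  derivative is at most \<open>D * B * M ^ i * i! powr s\<close>, with \<open>B\<close> and \<open>M\<close> independent of the sequence
  (\<open>stepped_power_series_gevrey\<close>). This is applied to the full coefficients, with
  \<open>D = A * \<parallel>\<theta>\<^sub>0\<parallel>\<close>, and to their difference from the truncated ones, where \<open>D\<close> carries the additional
  factor \<open>(r / \<rho>) ^ K + exp (- \<beta> * N\<^sup>2)\<close>. As \<open>s < 2\<close>, the weights \<open>M ^ i * i! powr s / (2 * i)!\<close> are
  summable, and their tail beyond \<open>I\<close> decays like \<open>exp (- (2 - s) / 2 * I * ln I)\<close>
  (\<open>gevrey_weight_tail\<close>). The terms \<open>i \<le> I\<close> of the error use the difference of the coefficients, and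
  the terms \<open>i > I\<close> only the full ones.
\<close>

section \<open>Factorials and Gevrey weights\<close>

text \<open>
  The exponential series, whose terms are nonnegative, exceeds each single term.
\<close>

lemma power_le_fact_mult_exp:
  fixes x :: real
  assumes "x \<ge> 0"
  shows "x ^ n \<le> fact n * exp x"
proof -
  have "(\<Sum>k\<in>{n}. x ^ k /\<^sub>R fact k) \<le> (\<Sum>k. x ^ k /\<^sub>R fact k)"
    using assms summable_exp_generic[of x] by (intro sum_le_suminf) auto
  then have "x ^ n / fact n \<le> exp x"
    by (simp add: exp_def divide_inverse mult.commute)
  then show ?thesis
    by (simp add: field_simps)
qed

lemma fact_mult_fact_le: "fact m * fact n \<le> (fact (m + n) :: real)"
proof -
  have "fact m * fact n \<le> (fact (m + n) :: nat)"
    by (intro dvd_imp_le fact_fact_dvd_fact) simp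
  then have "real (fact m * fact n) \<le> real (fact (m + n))"
    by (simp only: of_nat_le_iff)
  then show ?thesis by simp
qed

text \<open>
  Because \<open>(2 * i)! \<ge> (i!)\<^sup>2\<close>, the weight is at most \<open>M ^ i / i! powr (2 * \<sigma>)\<close> with
  \<open>\<sigma> = (2 - s) / 2\<close>. One factor \<open>i! powr - \<sigma>\<close> supplies the decay through \<open>n ^ n \<le> i! * exp i\<close> for
  \<open>n \<le> i\<close>, and the other one beats the geometric factors.
\<close>

lemma gevrey_weight_tail:
  fixes M s :: real
  assumes "M > 0" "s < 2"
  defines "w \<equiv> (\<lambda>i. M ^ i * fact i powr s / fact (2 * i))"
  shows "summable w"
    and "\<exists>W>0. \<forall>n. (\<Sum>i. w (i + Suc n)) \<le> W * exp (- ((2 - s) / 2) * real n * ln (real n))"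
proof -
  define \<sigma> where "\<sigma> = (2 - s) / 2"
  have \<sigma>: "\<sigma> > 0" using assms by (simp add: \<sigma>_def)
  \<comment> \<open>Chosen so that \<open>(K ^ i) powr \<sigma> = (2 * M * exp \<sigma>) ^ i\<close>; the 2 leaves a convergent geometric series.\<close>
  define K where "K = (2 * M * exp \<sigma>) powr (1 / \<sigma>)"
  have K: "K > 0" using assms by (simp add: K_def)
  have w0: "w i \<ge> 0" for i using assms by (simp add: w_def)
  have w: "w i \<le> exp (K * \<sigma>) * (1 / 2) ^ i * exp (- \<sigma> * real n * ln (real n))" if "n \<le> i" for i n
  proof -
    have "real n ^ n \<le> fact n * exp (real n)"
      by (rule power_le_fact_mult_exp) simp
    also have "\<dots> \<le> fact i * exp (real i)"
      using that by (intro mult_mono fact_mono) auto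
    finally have "exp (real n * ln (real n)) \<le> fact i * exp (real i)"
      by (cases "n = 0") (auto simp: exp_of_nat_mult)
    then have "exp (real n * ln (real n)) powr \<sigma> \<le> (fact i * exp (real i)) powr \<sigma>"
      using \<sigma> by (intro powr_mono2) auto
    then have 1: "exp (\<sigma> * real n * ln (real n)) \<le> fact i powr \<sigma> * exp (\<sigma> * real i)"
      by (simp add: powr_mult exp_powr_real mult_ac)
    have "K ^ i \<le> fact i * exp K"
      using K by (intro power_le_fact_mult_exp) simp
    then have "(K ^ i) powr \<sigma> \<le> (fact i * exp K) powr \<sigma>"
      using \<sigma> K by (intro powr_mono2) auto
    moreover have "(K ^ i) powr \<sigma> = (2 * M * exp \<sigma>) ^ i"
      using assms \<sigma> by (simp add: K_def powr_powr flip: powr_realpow)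
    ultimately have 2: "2 ^ i * (M ^ i * exp (\<sigma> * real i)) \<le> fact i powr \<sigma> * exp (K * \<sigma>)"
      by (simp add: powr_mult exp_powr_real power_mult_distrib exp_of_nat2_mult mult_ac)
    have "w i \<le> M ^ i * fact i powr s / (fact i * fact i)"
      unfolding w_def using assms fact_mult_fact_le[of i i]
      by (intro divide_left_mono) (auto simp: mult_2)
    also have "\<dots> = M ^ i * (fact i powr s / (fact i * fact i))"
      by simp
    also have "fact i powr s / (fact i * fact i) = 1 / (fact i powr \<sigma> * fact i powr \<sigma>)"
    proof -
      have "fact i powr s * (fact i powr \<sigma> * fact i powr \<sigma>) = fact i powr (2 :: real)"
        by (simp add: \<sigma>_def field_simps flip: powr_add)
      also have "\<dots> = fact i * fact i"
        by (simp add: power2_eq_square)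
      finally show ?thesis by (simp add: field_simps)
    qed
    also have "M ^ i * (1 / (fact i powr \<sigma> * fact i powr \<sigma>)) = M ^ i / (fact i powr \<sigma> * fact i powr \<sigma>)"
      by simp
    finally have "w i \<le> M ^ i / (fact i powr \<sigma> * fact i powr \<sigma>)"
      .
    also have "\<dots> \<le> exp (K * \<sigma>) * (1 / 2) ^ i * exp (- \<sigma> * real n * ln (real n))"
    proof -
      define F where "F = fact i powr \<sigma>"
      have F: "F > 0" by (simp add: F_def)
      have "(2 ^ i * M ^ i) * exp (\<sigma> * real n * ln (real n))
          \<le> (2 ^ i * M ^ i) * (F * exp (\<sigma> * real i))"
        using 1 assms by (intro mult_left_mono) (auto simp: F_def)
      also have "\<dots> \<le> F * (F * exp (K * \<sigma>))"
        using mult_left_mono[OF 2, of F] F by (simp add: F_def mult_ac)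
      finally show ?thesis
        using F unfolding F_def[symmetric]
        by (simp add: exp_minus field_simps power_divide)
    qed
    finally show ?thesis .
  qed
  have geo: "summable (\<lambda>i. exp (K * \<sigma>) * (1 / 2) ^ i :: real)"
    by (intro summable_mult summable_geometric) simp
  show sw: "summable w"
    using w[of 0] w0 by (intro summable_comparison_test'[OF geo, of 0]) auto
  show "\<exists>W>0. \<forall>n. (\<Sum>i. w (i + Suc n)) \<le> W * exp (- ((2 - s) / 2) * real n * ln (real n))"
  proof (intro exI[of _ "exp (K * \<sigma>) * 2"] conjI allI)
    fix n
    let ?e = "exp (- \<sigma> * real n * ln (real n))"
    have "(\<Sum>i. w (i + Suc n)) \<le> (\<Sum>i. exp (K * \<sigma>) * ?e * (1 / 2) ^ i)"
    proof (rule suminf_le)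
      fix i
      have "w (i + Suc n) \<le> exp (K * \<sigma>) * (1 / 2) ^ (i + Suc n) * ?e"
        by (rule w) simp
      also have "\<dots> \<le> exp (K * \<sigma>) * (1 / 2) ^ i * ?e"
        by (intro mult_left_mono mult_right_mono power_decreasing) auto
      finally show "w (i + Suc n) \<le> exp (K * \<sigma>) * ?e * (1 / 2) ^ i"
        by (simp add: mult_ac)
    qed (use sw in \<open>auto intro!: summable_mult summable_geometric summable_ignore_initial_segment
                     simp del: add_Suc_right\<close>)
    also have "\<dots> = exp (K * \<sigma>) * 2 * ?e"
      by (subst suminf_mult) (auto intro!: summable_geometric simp: suminf_geometric)
    finally show "(\<Sum>i. w (i + Suc n)) \<le> exp (K * \<sigma>) * 2 * exp (- ((2 - s) / 2) * real n * ln (real n))"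
      by (simp add: \<sigma>_def)
  qed simp
qed

section \<open>Products of functions given with their derivatives\<close>

text \<open>
  The functions \<open>F m\<close> and \<open>G m\<close> stand for the \<open>m\<close>-th derivatives of \<open>F 0\<close> and \<open>G 0\<close>. Carrying the
  sequence of derivatives along as data separates their existence from their size.
\<close>

definition leibniz_sum ::
  "(nat \<Rightarrow> real \<Rightarrow> complex) \<Rightarrow> (nat \<Rightarrow> real \<Rightarrow> complex) \<Rightarrow> nat \<Rightarrow> real \<Rightarrow> complex" where
  "leibniz_sum F G i t = (\<Sum>j\<le>i. of_nat (i choose j) * F (i - j) t * G j t)"

lemma has_vector_derivative_leibniz_sum:
  assumes F: "\<And>m. (F m has_vector_derivative F (Suc m) t) (at t)"
    and G: "\<And>m. (G m has_vector_derivative G (Suc m) t) (at t)"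
  shows "(leibniz_sum F G i has_vector_derivative leibniz_sum F G (Suc i) t) (at t)"
proof -
  have "leibniz_sum F G (Suc i) t =
      F (Suc i) t * G 0 t + (\<Sum>j\<le>i. of_nat (Suc i choose Suc j) * F (i - j) t * G (Suc j) t)"
    unfolding leibniz_sum_def by (subst sum.atMost_Suc_shift) simp
  also have "\<dots> = (F (Suc i) t * G 0 t + (\<Sum>j\<le>i. of_nat (i choose Suc j) * F (i - j) t * G (Suc j) t))
      + (\<Sum>j\<le>i. of_nat (i choose j) * F (i - j) t * G (Suc j) t)"
    by (simp add: algebra_simps sum.distrib)
  also have "F (Suc i) t * G 0 t + (\<Sum>j\<le>i. of_nat (i choose Suc j) * F (i - j) t * G (Suc j) t)
      = (\<Sum>j\<le>Suc i. of_nat (i choose j) * F (Suc i - j) t * G j t)"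
    by (subst sum.atMost_Suc_shift) simp
  also have "\<dots> = (\<Sum>j\<le>i. of_nat (i choose j) * F (Suc (i - j)) t * G j t)"
    by (simp add: Suc_diff_le)
  finally have eq: "leibniz_sum F G (Suc i) t =
      (\<Sum>j\<le>i. of_nat (i choose j) * F (i - j) t * G (Suc j) t + of_nat (i choose j) * F (Suc (i - j)) t * G j t)"
    by (simp add: sum.distrib add.commute)
  show ?thesis
    unfolding eq unfolding leibniz_sum_def
    by (intro has_vector_derivative_sum has_vector_derivative_mult has_vector_derivative_mult_right F G)
qed

text \<open>
  Gevrey order \<open>s \<ge> 1\<close> is stable under multiplication by an analytic function:
  \<open>(i - j)! powr s * j! \<le> i! powr s\<close>, and the geometric factors add up by the binomial theorem.
\<close>

lemma norm_leibniz_sum_le: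
  assumes F: "\<And>m. cmod (F m t) \<le> A * M ^ m * fact m powr s"
    and G: "\<And>m. cmod (G m t) \<le> B * L ^ m * fact m"
    and pos: "A \<ge> 0" "B \<ge> 0" "M \<ge> 0" "L \<ge> 0" "s \<ge> 1"
  shows "cmod (leibniz_sum F G i t) \<le> A * B * (L + M) ^ i * fact i powr s"
proof -
  have "cmod (leibniz_sum F G i t) \<le>
      (\<Sum>j\<le>i. real (i choose j) * cmod (F (i - j) t) * cmod (G j t))"
    unfolding leibniz_sum_def by (rule sum_norm_le[THEN order_trans[rotated]])
      (auto simp: norm_mult)
  also have "\<dots> \<le> (\<Sum>j\<le>i. (A * B * fact i powr s) * (real (i choose j) * L ^ j * M ^ (i - j)))"
  proof (rule sum_mono)
    fix j assume j: "j \<in> {..i}"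
    have "fact (i - j) powr s * fact j \<le> fact (i - j) powr s * fact j powr s"
      using pos powr_mono[of 1 s "fact j"] by (intro mult_left_mono) auto
    also have "\<dots> = (fact (i - j) * fact j) powr s"
      by (simp add: powr_mult)
    also have "\<dots> \<le> fact i powr s"
      using fact_mult_fact_le[of "i - j" j] j pos by (intro powr_mono2) auto
    finally have f: "fact (i - j) powr s * fact j \<le> fact i powr s" .
    have "real (i choose j) * cmod (F (i - j) t) * cmod (G j t)
        \<le> real (i choose j) * (A * M ^ (i - j) * fact (i - j) powr s) * (B * L ^ j * fact j)"
      using pos by (intro mult_mono F G mult_nonneg_nonneg) auto
    also have "\<dots> = (A * B * (real (i choose j) * L ^ j * M ^ (i - j))) * (fact (i - j) powr s * fact j)"
      by (simp add: mult_ac)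
    also have "\<dots> \<le> (A * B * (real (i choose j) * L ^ j * M ^ (i - j))) * fact i powr s"
      using pos f by (intro mult_left_mono) auto
    finally show "real (i choose j) * cmod (F (i - j) t) * cmod (G j t)
        \<le> (A * B * fact i powr s) * (real (i choose j) * L ^ j * M ^ (i - j))"
      by (simp add: mult_ac)
  qed
  also have "\<dots> = A * B * (L + M) ^ i * fact i powr s"
    unfolding sum_distrib_left[symmetric] by (simp add: binomial_ring mult_ac)
  finally show ?thesis .
qed

text \<open>
  Any sequence of successive derivatives computes the iterated derivative on the interval, so bounds
  may be proved for a convenient sequence.
\<close>

lemma nth_deriv_on_eq:
  fixes Y :: "nat \<Rightarrow> real \<Rightarrow> complex"
  assumes "a < b"
    and f: "\<And>t. t \<in> {a..b} \<Longrightarrow> f t = Y 0 t"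
    and Y: "\<And>i t. t \<in> {a..b} \<Longrightarrow> (Y i has_vector_derivative Y (Suc i) t) (at t within {a..b})"
    and "t \<in> {a..b}"
  shows "nth_deriv_on {a..b} i f t = Y i t"
  using \<open>t \<in> {a..b}\<close>
proof (induction i arbitrary: t)
  case 0
  then show ?case by (simp add: f)
next
  case (Suc i)
  have "(nth_deriv_on {a..b} i f has_vector_derivative Y (Suc i) t) (at t within {a..b})"
    by (rule has_vector_derivative_transform[OF Suc.prems Suc.IH Y[OF Suc.prems]])
  then show ?case
    using Suc.prems \<open>a < b\<close> by (simp add: vector_derivative_within_closed_interval)
qed

section \<open>Power series with a geometric majorant\<close>

lemma power_series_majorised:
  fixes a :: "nat \<Rightarrow> complex"
  assumes a: "\<And>k. cmod (a k) \<le> D / r ^ k" and "r > 0" "cmod z < r"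
  shows "summable (\<lambda>k. a k * z ^ k)" "cmod (\<Sum>k. a k * z ^ k) \<le> D / (1 - cmod z / r)"
proof -
  have n: "cmod (a k * z ^ k) \<le> D * (cmod z / r) ^ k" for k
    using mult_right_mono[OF a[of k], of "cmod z ^ k"] by (simp add: norm_mult norm_power power_divide)
  have g: "summable (\<lambda>k. D * (cmod z / r) ^ k)"
    using assms by (intro summable_mult summable_geometric) simp
  show "summable (\<lambda>k. a k * z ^ k)"
    by (rule summable_comparison_test'[OF g]) (rule n)
  have "cmod (\<Sum>k. a k * z ^ k) \<le> (\<Sum>k. D * (cmod z / r) ^ k)"
    by (rule norm_suminf_le[OF n g])
  also have "\<dots> = D / (1 - cmod z / r)"
    using assms by (simp add: suminf_mult suminf_geometric summable_geometric)
  finally show "cmod (\<Sum>k. a k * z ^ k) \<le> D / (1 - cmod z / r)" .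
qed

lemma holomorphic_power_series_majorised:
  fixes a :: "nat \<Rightarrow> complex"
  assumes a: "\<And>k. cmod (a k) \<le> D / r ^ k" and "r > 0"
  shows "(\<lambda>z. \<Sum>k. a k * z ^ k) holomorphic_on ball 0 r"
  by (rule power_series_holomorphic[where a = a])
     (use power_series_majorised(1)[OF a] assms(2) in \<open>auto intro!: summable_sums\<close>)

text \<open>
  Cauchy's inequality on the disc of radius \<open>(r - R) / 2\<close> around \<open>z\<close>, which stays inside the disc of
  convergence.
\<close>

lemma higher_deriv_power_series_bound:
  fixes a :: "nat \<Rightarrow> complex"
  assumes a: "\<And>k. cmod (a k) \<le> D / r ^ k" and "R < r" "cmod z \<le> R"
  shows "cmod ((deriv ^^ j) (\<lambda>z. \<Sum>k. a k * z ^ k) z)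
    \<le> D * (2 * r / (r - R)) * (2 / (r - R)) ^ j * fact j"
proof -
  define h where "h = (r - R) / 2"
  have h: "h > 0" "R + h < r" using assms by (simp_all add: h_def field_simps)
  have "0 \<le> R" using assms(3) norm_ge_zero order_trans by blast
  have r: "r > 0" using \<open>0 \<le> R\<close> assms by simp
  have D: "D \<ge> 0" using order_trans[OF norm_ge_zero a[of 0]] by simp
  let ?f = "\<lambda>z. \<Sum>k. a k * z ^ k"
  have sub: "cball z h \<subseteq> ball 0 r"
  proof
    fix x assume "x \<in> cball z h"
    then have "cmod x \<le> cmod z + h"
      using norm_triangle_ineq2[of x z] by (simp add: dist_norm norm_minus_commute)
    then show "x \<in> ball 0 r" using h assms by simp
  qed
  have hol: "?f holomorphic_on ball 0 r"
    using holomorphic_power_series_majorised[OF a r] .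
  have "cmod ((deriv ^^ j) ?f z) \<le> fact j * (D * (2 * r / (r - R))) / h ^ j"
  proof (rule Cauchy_inequality)
    show "?f holomorphic_on ball z h"
      using hol sub ball_subset_cball holomorphic_on_subset by (metis (no_types, lifting) subset_trans)
    show "continuous_on (cball z h) ?f"
      using hol sub holomorphic_on_imp_continuous_on continuous_on_subset by blast
    fix x assume x: "cmod (z - x) = h"
    then have "cmod x \<le> R + h"
      using norm_triangle_ineq2[of x z] assms by (simp add: norm_minus_commute)
    moreover have "cmod x < r" using calculation h by simp
    ultimately have "cmod (?f x) \<le> D / (1 - cmod x / r)"
      by (intro power_series_majorised(2)[OF a r])
    also have "\<dots> \<le> D / (1 - (R + h) / r)"
      using D h r \<open>cmod x \<le> R + h\<close> \<open>cmod x < r\<close> by (intro divide_left_mono diff_left_mono divide_right_mono mult_pos_pos) auto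
    also have "1 - (R + h) / r = (r - R) / (2 * r)"
      using r by (simp add: h_def field_simps)
    finally show "cmod (?f x) \<le> D * (2 * r / (r - R))"
      by simp
  qed (use h in auto)
  then show ?thesis
    by (simp add: h_def power_divide field_simps)
qed

section \<open>Holomorphic extension of the step function\<close>

text \<open>
  Dividing numerator and denominator of the step function by \<open>exp (- ((1 - t) powr - \<kappa>))\<close> leaves
  \<open>1 / (1 + exp w)\<close> with the exponent \<open>w\<close> below; in this form zeros of the denominator are controlled by
  the real and imaginary parts of \<open>w\<close>.
\<close>

definition step_exponent :: "real \<Rightarrow> complex \<Rightarrow> complex" where
  "step_exponent \<kappa> z = (1 - z) powr (- of_real \<kappa>) - z powr (- of_real \<kappa>)"

definition complex_step :: "real \<Rightarrow> complex \<Rightarrow> complex" where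
  "complex_step \<kappa> z = 1 / (1 + exp (step_exponent \<kappa> z))"

lemma step_fun_eq_complex_step:
  assumes "0 < t" "t < 1"
  shows "of_real (step_fun s t) = complex_step (1 / (s - 1)) (of_real t)"
proof -
  define \<kappa> where "\<kappa> = 1 / (s - 1)"
  define a where "a = (1 - t) powr (-\<kappa>)"
  define b where "b = t powr (-\<kappa>)"
  have "1 - complex_of_real t = of_real (1 - t)" by simp
  then have "step_exponent \<kappa> (of_real t) = of_real (a - b)"
    using assms unfolding step_exponent_def a_def b_def
    by (simp only: flip: of_real_minus) (simp add: powr_of_real del: of_real_minus of_real_diff flip: of_real_diff of_real_minus)
  then have "complex_step \<kappa> (of_real t) = of_real (1 / (1 + exp (a - b)))"
    by (simp add: complex_step_def flip: exp_of_real)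
  also have "1 / (1 + exp (a - b)) = exp (- a) / (exp (- a) + exp (- b))"
    by (simp add: field_simps exp_diff exp_minus)
  also have "\<dots> = step_fun s t"
    using assms by (simp add: step_fun_def Let_def \<kappa>_def a_def b_def)
  finally show ?thesis by (simp add: \<kappa>_def)
qed

text \<open>
  The exponent is odd under \<open>z \<mapsto> 1 - z\<close>. Hence estimates near 1 follow from those near 0.
\<close>

lemma complex_step_reflect:
  assumes "1 + exp (step_exponent \<kappa> z) \<noteq> 0"
  shows "1 + exp (step_exponent \<kappa> (1 - z)) \<noteq> 0" "complex_step \<kappa> (1 - z) = 1 - complex_step \<kappa> z"
proof -
  define E where "E = exp (step_exponent \<kappa> z)"
  have "step_exponent \<kappa> (1 - z) = - step_exponent \<kappa> z"
    by (simp add: step_exponent_def)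
  then have "exp (step_exponent \<kappa> (1 - z)) = 1 / E"
    by (simp add: E_def exp_minus divide_inverse)
  moreover have "E \<noteq> 0" "1 + E \<noteq> 0" using assms by (auto simp: E_def)
  then have "1 + 1 / E = (1 + E) / E" "1 / (1 + E) = 1 - 1 / ((1 + E) / E)"
    by (auto simp: field_simps)
  ultimately show "1 + exp (step_exponent \<kappa> (1 - z)) \<noteq> 0" "complex_step \<kappa> (1 - z) = 1 - complex_step \<kappa> z"
    using \<open>E \<noteq> 0\<close> \<open>1 + E \<noteq> 0\<close> unfolding complex_step_def E_def[symmetric] by auto
qed

text \<open>
  By homogeneity of \<open>z \<mapsto> z powr - \<kappa>\<close>, continuity at 1 becomes an estimate for the relative error that
  is uniform in the centre \<open>a > 0\<close>.
\<close>

lemma powr_relative_continuity: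
  fixes \<kappa> \<epsilon> :: real
  assumes "\<epsilon> > 0"
  obtains \<delta> where "\<delta> > 0" "\<delta> \<le> 1 / 2"
    "\<And>a z. a > 0 \<Longrightarrow> cmod (z - of_real a) \<le> \<delta> * a \<Longrightarrow>
      cmod (z powr (- of_real \<kappa>) - of_real (a powr (- \<kappa>))) \<le> \<epsilon> * a powr (- \<kappa>)"
proof -
  have "isCont (\<lambda>\<zeta>. \<zeta> powr (- of_real \<kappa> :: complex)) 1"
    by (intro continuous_intros) (auto simp: complex_nonpos_Reals_iff)
  then obtain d where d: "d > 0" "\<And>\<zeta>. dist \<zeta> 1 < d \<Longrightarrow> dist (\<zeta> powr (- of_real \<kappa> :: complex)) 1 < \<epsilon>"
    using assms unfolding continuous_at_eps_delta by (metis powr_one_eq_one)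
  show thesis
  proof (rule that[of "min (d / 2) (1 / 2)"])
    fix a z assume a: "a > (0::real)" and z: "cmod (z - of_real a) \<le> min (d / 2) (1 / 2) * a"
    have "cmod (z / of_real a - 1) = cmod (z - of_real a) / a"
      using a by (simp add: divide_diff_eq_iff norm_divide)
    also have "\<dots> \<le> min (d / 2) (1 / 2)"
      using a z by (simp only: pos_divide_le_eq)
    also have "\<dots> < d" using d by simp
    finally have "cmod ((z / of_real a) powr (- of_real \<kappa>) - 1) < \<epsilon>"
      using d(2)[of "z / of_real a"] by (simp add: dist_norm)
    moreover have "z powr (- of_real \<kappa>) = of_real (a powr (- \<kappa>)) * (z / of_real a) powr (- of_real \<kappa>)"
    proof -
      have "z powr (- of_real \<kappa>) = (of_real a * (z / of_real a)) powr (- of_real \<kappa>)"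
        using a by simp
      also have "\<dots> = of_real a powr (- of_real \<kappa>) * (z / of_real a) powr (- of_real \<kappa>)"
        using a by (intro powr_times_real_left) auto
      also have "of_real a powr (- of_real \<kappa>) = complex_of_real (a powr (- \<kappa>))"
        using a powr_of_real[of a "-\<kappa>"] by simp
      finally show ?thesis .
    qed
    then have "z powr (- of_real \<kappa>) - of_real (a powr (- \<kappa>))
        = of_real (a powr (- \<kappa>)) * ((z / of_real a) powr (- of_real \<kappa>) - 1)"
      by (simp add: algebra_simps)
    ultimately show "cmod (z powr (- of_real \<kappa>) - of_real (a powr (- \<kappa>))) \<le> \<epsilon> * a powr (- \<kappa>)"
      using a by (simp add: norm_mult mult.commute mult_left_mono)
  qed (use d in auto)
qed

text \<open>
  Write \<open>v = t powr - \<kappa>\<close> and \<open>u = (1 - t) powr - \<kappa> \<le> 2 powr \<kappa>\<close>. On the disc of radius \<open>\<delta> * t\<close> the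
  exponent \<open>w\<close> is within \<open>\<epsilon> * (u + v)\<close> of the real number \<open>u - v\<close>. If \<open>v\<close> is large, then \<open>exp w\<close> is
  small; if \<open>v\<close> is bounded, then the imaginary part of \<open>w\<close> is below \<open>pi / 2\<close> and \<open>exp w\<close> has
  nonnegative real part. In both cases \<open>1 + exp w\<close> stays away from 0.
\<close>

lemma complex_step_near_0:
  fixes \<kappa> :: real
  assumes "\<kappa> > 0"
  obtains \<delta> B where "\<delta> > 0" "\<delta> \<le> 1 / 2" "B > 0"
    "\<And>t z. 0 < t \<Longrightarrow> t \<le> 1 / 2 \<Longrightarrow> cmod (z - of_real t) \<le> \<delta> * t \<Longrightarrow>
       1 + exp (step_exponent \<kappa> z) \<noteq> 0 \<and>
       cmod (complex_step \<kappa> z - 1) \<le> B * exp (- (t powr (- \<kappa>)) / 2)"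
proof -
  define P where "P = 2 powr \<kappa>"
  have P: "P \<ge> 1" using assms by (simp add: P_def ge_one_powr_ge_zero)
  \<comment> \<open>In the case of bounded \<open>v\<close>, that is \<open>v \<le> 4 * P\<close>, this makes \<open>\<epsilon> * v \<le> 1 / 2\<close>.\<close>
  define \<epsilon> where "\<epsilon> = 1 / (8 * P)"
  have \<epsilon>: "\<epsilon> > 0" "\<epsilon> \<le> 1 / 8" "\<epsilon> * P = 1 / 8"
    using P by (auto simp: \<epsilon>_def field_simps)
  obtain \<delta> where \<delta>: "\<delta> > 0" "\<delta> \<le> 1 / 2"
    and near: "\<And>a z. a > 0 \<Longrightarrow> cmod (z - of_real a) \<le> \<delta> * a \<Longrightarrow>
      cmod (z powr (- of_real \<kappa>) - of_real (a powr (- \<kappa>))) \<le> \<epsilon> * a powr (- \<kappa>)"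
    using powr_relative_continuity[OF \<epsilon>(1), of \<kappa>] by blast
  show thesis
  proof (rule that[OF \<delta>, of "2 * exp (2 * P)"])
    fix t z assume t: "0 < t" "t \<le> 1 / (2::real)" and z: "cmod (z - of_real t) \<le> \<delta> * t"
    define v where "v = t powr (- \<kappa>)"
    define u where "u = (1 - t) powr (- \<kappa>)"
    have u: "u \<le> P" "u > 0"
    proof -
      have "u \<le> (1 / 2) powr (- \<kappa>)"
        unfolding u_def using t assms by (intro powr_mono2') auto
      also have "\<dots> = P" by (simp add: P_def powr_minus powr_divide)
      finally show "u \<le> P" .
      show "u > 0" using t by (simp add: u_def)
    qed
    have v: "v \<ge> P"
    proof -
      have "P = (1 / 2) powr (- \<kappa>)" by (simp add: P_def powr_minus powr_divide)
      also have "\<dots> \<le> v"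
        unfolding v_def using t assms by (intro powr_mono2') auto
      finally show ?thesis .
    qed
    have z1: "cmod (z powr (- of_real \<kappa>) - of_real v) \<le> \<epsilon> * v"
      unfolding v_def using t z by (intro near) auto
    have "cmod ((1 - z) - of_real (1 - t)) \<le> \<delta> * (1 - t)"
    proof -
      have "cmod ((1 - z) - of_real (1 - t)) = cmod (z - of_real t)"
        by (simp add: norm_minus_commute)
      also have "\<dots> \<le> \<delta> * t" by (rule z)
      also have "\<dots> \<le> \<delta> * (1 - t)" using t \<delta> by simp
      finally show ?thesis .
    qed
    then have z2: "cmod ((1 - z) powr (- of_real \<kappa>) - of_real u) \<le> \<epsilon> * u"
      unfolding u_def using t by (intro near) auto
    have w: "cmod (step_exponent \<kappa> z - of_real (u - v)) \<le> \<epsilon> * u + \<epsilon> * v"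
    proof -
      have eq: "step_exponent \<kappa> z - of_real (u - v) =
          ((1 - z) powr (- of_real \<kappa>) - of_real u) - (z powr (- of_real \<kappa>) - of_real v)"
        by (simp add: step_exponent_def)
      show ?thesis
        unfolding eq by (rule order_trans[OF norm_triangle_ineq4 add_mono[OF z2 z1]])
    qed
    let ?w = "step_exponent \<kappa> z"
    have \<epsilon>u: "\<epsilon> * u \<le> 1 / 8" using mult_left_mono[OF u(1), of \<epsilon>] \<epsilon> by simp
    have Re: "Re ?w \<le> 2 * P - 3 / 4 * v"
    proof -
      have "Re ?w - (u - v) \<le> \<epsilon> * u + \<epsilon> * v"
        using w complex_Re_le_cmod[of "?w - of_real (u - v)"] by simp
      moreover have "\<epsilon> * v \<le> 1 / 8 * v" using \<epsilon> v P by (intro mult_right_mono) auto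
      ultimately show ?thesis using u v P \<epsilon>u by linarith
    qed
    have Im: "\<bar>Im ?w\<bar> \<le> 1 / 8 + \<epsilon> * v"
      using w abs_Im_le_cmod[of "?w - of_real (u - v)"] \<epsilon>u by simp
    have lower: "1 / 2 \<le> cmod (1 + exp ?w)"
    proof (cases "2 * P - 3 / 4 * v \<le> - 1")
      case True
      then have "Re ?w \<le> -1" using Re by simp
      then have "cmod (exp ?w) \<le> exp (-1)" by simp
      also have "exp (-1 :: real) \<le> 1 / 2"
        using exp_ge_add_one_self[of "1::real"] by (simp add: exp_minus field_simps)
      finally show ?thesis
        using norm_diff_ineq[of 1 "exp ?w"] by simp
    next
      case False
      then have "v \<le> 4 * P" using P by simp
      then have "\<epsilon> * v \<le> \<epsilon> * (4 * P)" using \<epsilon> by (intro mult_left_mono) auto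
      then have "\<epsilon> * v \<le> 1 / 2" using \<epsilon>(3) by simp
      then have "\<bar>Im ?w\<bar> \<le> pi / 2" using Im pi_gt3 by linarith
      then have "cos (Im ?w) \<ge> 0" by (intro cos_ge_zero) auto
      then have "Re (1 + exp ?w) \<ge> 1" by (simp add: Re_exp)
      then show ?thesis using complex_Re_le_cmod[of "1 + exp ?w"] by linarith
    qed
    then have ne: "1 + exp ?w \<noteq> 0" by auto
    have "complex_step \<kappa> z - 1 = - exp ?w / (1 + exp ?w)"
      using ne by (simp add: complex_step_def field_simps)
    then have "cmod (complex_step \<kappa> z - 1) = cmod (exp ?w) / cmod (1 + exp ?w)"
      by (simp add: norm_divide)
    also have "\<dots> \<le> cmod (exp ?w) / (1 / 2)"
      using lower by (intro divide_left_mono) auto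
    also have "\<dots> = 2 * exp (Re ?w)" by simp
    also have "\<dots> \<le> 2 * exp (2 * P + - v / 2)"
      using Re v P by simp
    also have "\<dots> = 2 * exp (2 * P) * exp (- v / 2)"
      by (simp only: exp_add mult.assoc)
    finally show "1 + exp ?w \<noteq> 0 \<and> cmod (complex_step \<kappa> z - 1) \<le> 2 * exp (2 * P) * exp (- (t powr (- \<kappa>)) / 2)"
      using ne by (simp add: v_def)
  qed simp
qed

definition step_domain :: "real \<Rightarrow> complex set" where
  "step_domain \<kappa> = {z. 0 < Re z \<and> Re z < 1 \<and> 1 + exp (step_exponent \<kappa> z) \<noteq> 0}"

lemma holomorphic_step_exponent:
  "step_exponent \<kappa> holomorphic_on {z. 0 < Re z \<and> Re z < 1}"
  unfolding step_exponent_def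
  by (intro holomorphic_intros) (auto simp: complex_nonpos_Reals_iff)

lemma open_step_domain: "open (step_domain \<kappa>)"
proof -
  have strip: "open {z. 0 < Re z \<and> Re z < 1}"
    using open_Int[OF open_halfspace_Re_gt[of 0] open_halfspace_Re_lt[of 1]] by (simp add: Collect_conj_eq)
  have "continuous_on {z. 0 < Re z \<and> Re z < 1} (\<lambda>z. 1 + exp (step_exponent \<kappa> z))"
    by (intro continuous_intros holomorphic_on_imp_continuous_on holomorphic_step_exponent)
  from continuous_open_preimage[OF this strip, of "- {0}"]
  moreover have "open (- {0 :: complex})" by blast
  ultimately show ?thesis
    by (simp add: step_domain_def vimage_def Int_def conj_assoc)
qed

lemma holomorphic_complex_step: "complex_step \<kappa> holomorphic_on step_domain \<kappa>"
  unfolding complex_step_def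
  by (intro holomorphic_intros holomorphic_on_subset[OF holomorphic_step_exponent])
     (auto simp: step_domain_def)

lemma complex_step_disc:
  fixes \<kappa> :: real
  assumes "\<kappa> > 0"
  obtains \<delta> B where "\<delta> > 0" "B > 0"
    "\<And>t. 0 < t \<Longrightarrow> t \<le> 1 / 2 \<Longrightarrow> cball (of_real t) (\<delta> * t) \<subseteq> step_domain \<kappa>"
    "\<And>t z. 0 < t \<Longrightarrow> t \<le> 1 / 2 \<Longrightarrow> z \<in> cball (of_real t) (\<delta> * t) \<Longrightarrow>
       cmod (complex_step \<kappa> z - 1) \<le> B * exp (- (t powr (- \<kappa>)) / 2)"
    "\<And>t. 0 < t \<Longrightarrow> t \<le> 1 / 2 \<Longrightarrow> cball (of_real (1 - t)) (\<delta> * t) \<subseteq> step_domain \<kappa>"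
    "\<And>t z. 0 < t \<Longrightarrow> t \<le> 1 / 2 \<Longrightarrow> z \<in> cball (of_real (1 - t)) (\<delta> * t) \<Longrightarrow>
       cmod (complex_step \<kappa> z - 0) \<le> B * exp (- (t powr (- \<kappa>)) / 2)"
proof -
  obtain \<delta> B where \<delta>: "\<delta> > 0" "\<delta> \<le> 1 / 2" "B > 0"
    and near: "\<And>t z. 0 < t \<Longrightarrow> t \<le> 1 / 2 \<Longrightarrow> cmod (z - of_real t) \<le> \<delta> * t \<Longrightarrow>
       1 + exp (step_exponent \<kappa> z) \<noteq> 0 \<and>
       cmod (complex_step \<kappa> z - 1) \<le> B * exp (- (t powr (- \<kappa>)) / 2)"
    using complex_step_near_0[OF assms] by blast
  have Re: "0 < Re z \<and> Re z < 1" if "0 < t" "t \<le> 1 / 2" "cmod (z - of_real t) \<le> \<delta> * t" for t and z :: complex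
  proof -
    have "\<bar>Re z - t\<bar> \<le> \<delta> * t"
      using abs_Re_le_cmod[of "z - of_real t"] that by simp
    also have "\<dots> \<le> 1 / 2 * t" using that \<delta> by (intro mult_right_mono) auto
    finally show ?thesis using that by linarith
  qed
  have refl: "cmod ((1 - z) - of_real t) \<le> \<delta> * t" if "z \<in> cball (of_real (1 - t)) (\<delta> * t)" for t and z :: complex
  proof -
    have "(1 - z) - of_real t = of_real (1 - t) - z" by simp
    then show ?thesis using that by (metis dist_norm mem_cball)
  qed
  show thesis
  proof (rule that[OF \<delta>(1,3)])
    fix t :: real assume t: "0 < t" "t \<le> 1 / 2"
    show "cball (of_real t) (\<delta> * t) \<subseteq> step_domain \<kappa>"
      using t near Re by (auto simp: step_domain_def dist_norm norm_minus_commute)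
    show "cball (of_real (1 - t)) (\<delta> * t) \<subseteq> step_domain \<kappa>"
    proof
      fix z :: complex assume z: "z \<in> cball (of_real (1 - t)) (\<delta> * t)"
      show "z \<in> step_domain \<kappa>"
        using Re[OF t refl[OF z]] near[OF t refl[OF z]] complex_step_reflect(1)[of \<kappa> "1 - z"]
        by (auto simp: step_domain_def)
    qed
    fix z :: complex
    show "cmod (complex_step \<kappa> z - 1) \<le> B * exp (- (t powr (- \<kappa>)) / 2)"
      if "z \<in> cball (of_real t) (\<delta> * t)"
      using that t near by (auto simp: dist_norm norm_minus_commute)
    show "cmod (complex_step \<kappa> z - 0) \<le> B * exp (- (t powr (- \<kappa>)) / 2)"
      if z: "z \<in> cball (of_real (1 - t)) (\<delta> * t)"
      using near[OF t refl[OF z]] complex_step_reflect(2)[of \<kappa> "1 - z"]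
      by (simp add: norm_minus_commute)
  qed
qed

section \<open>The step function is Gevrey of order s\<close>

text \<open>
  The extension is singular at 0 and 1; the values there are the one-sided limits from inside \<open>(0,1)\<close>, so
  that each function of the sequence is differentiable with the next one as derivative.
\<close>

definition step_deriv :: "real \<Rightarrow> nat \<Rightarrow> real \<Rightarrow> complex" where
  "step_deriv s m t =
     (if 0 < t \<and> t < 1 then (deriv ^^ m) (complex_step (1 / (s - 1))) (of_real t)
      else if t \<le> 0 \<and> m = 0 then 1 else 0)"

lemma step_deriv_0: "step_deriv s 0 t = of_real (step_fun s t)"
proof (cases "0 < t \<and> t < 1")
  case True
  then show ?thesis by (simp add: step_deriv_def step_fun_eq_complex_step)
next
  case False
  then show ?thesis by (auto simp: step_deriv_def step_fun_def Let_def)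
qed

text \<open>
  Subtracting a constant \<open>y\<close> affects no derivative of positive order, so only the oscillation of \<open>f\<close>
  around \<open>y\<close> enters Cauchy's inequality.
\<close>

lemma higher_deriv_bound_disc:
  assumes "f holomorphic_on S" "open S" "cball z r \<subseteq> S" "r > 0"
    and bnd: "\<And>w. w \<in> cball z r \<Longrightarrow> cmod (f w - y) \<le> B"
  shows "cmod ((deriv ^^ m) f z - (if m = 0 then y else 0)) \<le> fact m * B / r ^ m"
proof (cases "m = 0")
  case True
  then show ?thesis using bnd[of z] \<open>r > 0\<close> by simp
next
  case False
  have fS: "(\<lambda>w. f w - y) holomorphic_on S"
    using assms(1) by (intro holomorphic_intros)
  have "cmod ((deriv ^^ m) (\<lambda>w. f w - y) z) \<le> fact m * B / r ^ m"
  proof (rule Cauchy_inequality)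
    show "(\<lambda>w. f w - y) holomorphic_on ball z r"
      using fS assms(3) ball_subset_cball holomorphic_on_subset by (metis subset_trans)
    show "continuous_on (cball z r) (\<lambda>w. f w - y)"
      using fS assms(3) holomorphic_on_imp_continuous_on continuous_on_subset by blast
  qed (use assms in \<open>auto simp: dist_norm\<close>)
  moreover have "(deriv ^^ m) (\<lambda>w. f w - y) z = (deriv ^^ m) f z - (deriv ^^ m) (\<lambda>w. y) z"
    using assms by (intro higher_deriv_diff[of f S]) (auto intro: holomorphic_intros)
  ultimately show ?thesis
    using False by simp
qed

text \<open>
  With \<open>v = d powr - \<kappa>\<close> the left-hand side is the power with exponent \<open>1 / \<kappa>\<close> of
  \<open>v ^ m * exp (- \<kappa> * v / 2)\<close>. This is where the Gevrey order \<open>1 + 1 / \<kappa> = s\<close> comes from.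
\<close>

lemma inverse_power_times_exp_powr_le:
  fixes \<kappa> d :: real
  assumes "\<kappa> > 0" "d > 0"
  shows "exp (- (d powr (- \<kappa>)) / 2) / d ^ m \<le> ((2 / \<kappa>) powr (1 / \<kappa>)) ^ m * fact m powr (1 / \<kappa>)"
proof -
  define v where "v = d powr (- \<kappa>)"
  have v: "v > 0" using assms by (simp add: v_def)
  have "(\<kappa> * v / 2) ^ m \<le> fact m * exp (\<kappa> * v / 2)"
    using assms v by (intro power_le_fact_mult_exp) auto
  then have "v ^ m * exp (- (\<kappa> * v / 2)) \<le> (2 / \<kappa>) ^ m * fact m"
    using assms by (simp add: power_mult_distrib power_divide exp_minus field_simps)
  then have "(v ^ m * exp (- (\<kappa> * v / 2))) powr (1 / \<kappa>) \<le> ((2 / \<kappa>) ^ m * fact m) powr (1 / \<kappa>)"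
    using assms v by (intro powr_mono2) auto
  moreover have "(v ^ m * exp (- (\<kappa> * v / 2))) powr (1 / \<kappa>) = exp (- v / 2) / d ^ m"
  proof -
    have "(v ^ m) powr (1 / \<kappa>) = d powr (- real m)"
      using assms by (simp add: v_def powr_powr flip: powr_realpow)
    also have "\<dots> = 1 / d ^ m"
      using assms by (simp add: powr_minus powr_realpow divide_inverse)
    finally show ?thesis
      using assms v by (simp add: powr_mult exp_powr_real)
  qed
  moreover have "((2 / \<kappa>) ^ m * fact m) powr (1 / \<kappa>) = ((2 / \<kappa>) powr (1 / \<kappa>)) ^ m * fact m powr (1 / \<kappa>)"
    using assms by (simp add: powr_mult powr_powr powr_power mult.commute flip: powr_realpow)
  ultimately show ?thesis by (simp add: v_def)
qed

lemma step_deriv_near_ends: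
  assumes "s > 1"
  obtains \<delta> B where "\<delta> > 0" "B > 0"
    "\<And>m t. 0 < t \<Longrightarrow> t \<le> 1 / 2 \<Longrightarrow> cmod (step_deriv s m t - (if m = 0 then 1 else 0))
       \<le> B * fact m / \<delta> ^ m * (exp (- (t powr (- 1 / (s - 1))) / 2) / t ^ m)"
    "\<And>m t. 0 < t \<Longrightarrow> t \<le> 1 / 2 \<Longrightarrow> cmod (step_deriv s m (1 - t))
       \<le> B * fact m / \<delta> ^ m * (exp (- (t powr (- 1 / (s - 1))) / 2) / t ^ m)"
proof -
  define \<kappa> where "\<kappa> = 1 / (s - 1)"
  have "\<kappa> > 0" using assms by (simp add: \<kappa>_def)
  from complex_step_disc[OF this] obtain \<delta> B where \<delta>: "\<delta> > 0" "B > 0"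
    and disc: "\<And>t. 0 < t \<Longrightarrow> t \<le> 1 / 2 \<Longrightarrow> cball (of_real t) (\<delta> * t) \<subseteq> step_domain \<kappa>"
    "\<And>t z. 0 < t \<Longrightarrow> t \<le> 1 / 2 \<Longrightarrow> z \<in> cball (of_real t) (\<delta> * t) \<Longrightarrow>
       cmod (complex_step \<kappa> z - 1) \<le> B * exp (- (t powr (- \<kappa>)) / 2)"
    "\<And>t. 0 < t \<Longrightarrow> t \<le> 1 / 2 \<Longrightarrow> cball (of_real (1 - t)) (\<delta> * t) \<subseteq> step_domain \<kappa>"
    "\<And>t z. 0 < t \<Longrightarrow> t \<le> 1 / 2 \<Longrightarrow> z \<in> cball (of_real (1 - t)) (\<delta> * t) \<Longrightarrow>
       cmod (complex_step \<kappa> z - 0) \<le> B * exp (- (t powr (- \<kappa>)) / 2)"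
    by blast
  note bnd = higher_deriv_bound_disc[OF holomorphic_complex_step open_step_domain]
  show thesis
  proof (rule that[OF \<delta>])
    fix m and t :: real assume t: "0 < t" "t \<le> 1 / 2"
    have r: "\<delta> * t > 0" using t \<delta> by simp
    have \<kappa>': "- 1 / (s - 1) = - \<kappa>" by (simp add: \<kappa>_def)
    show "cmod (step_deriv s m t - (if m = 0 then 1 else 0))
       \<le> B * fact m / \<delta> ^ m * (exp (- (t powr (- 1 / (s - 1))) / 2) / t ^ m)"
      using bnd[OF disc(1)[OF t] r disc(2)[OF t], of m] t unfolding \<kappa>'
      by (simp add: step_deriv_def power_mult_distrib mult_ac flip: \<kappa>_def)
    show "cmod (step_deriv s m (1 - t))
       \<le> B * fact m / \<delta> ^ m * (exp (- (t powr (- 1 / (s - 1))) / 2) / t ^ m)"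
      using bnd[OF disc(3)[OF t] r disc(4)[OF t], of m] t unfolding \<kappa>'
      by (simp add: step_deriv_def power_mult_distrib mult_ac flip: \<kappa>_def)
  qed
qed

lemma step_deriv_gevrey:
  assumes "s > 1"
  obtains A M where "A > 0" "M > 0" "\<And>m t. cmod (step_deriv s m t) \<le> A * M ^ m * fact m powr s"
proof -
  obtain \<delta> B where \<delta>: "\<delta> > 0" "B > 0"
    and near: "\<And>m t. 0 < t \<Longrightarrow> t \<le> 1 / 2 \<Longrightarrow> cmod (step_deriv s m t - (if m = 0 then 1 else 0))
       \<le> B * fact m / \<delta> ^ m * (exp (- (t powr (- 1 / (s - 1))) / 2) / t ^ m)"
    "\<And>m t. 0 < t \<Longrightarrow> t \<le> 1 / 2 \<Longrightarrow> cmod (step_deriv s m (1 - t))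
       \<le> B * fact m / \<delta> ^ m * (exp (- (t powr (- 1 / (s - 1))) / 2) / t ^ m)"
    using step_deriv_near_ends[OF assms] by blast
  define Q where "Q = (2 * (s - 1)) powr (s - 1)"
  have Q: "Q > 0" using assms by (simp add: Q_def)
  \<comment> \<open>The \<open>1 +\<close> lets the right-hand side also dominate 1, the value of the step function left of 0.\<close>
  have one: "1 \<le> (1 + Q / \<delta>) ^ m * fact m powr s" for m
  proof -
    have "1 * 1 \<le> (1 + Q / \<delta>) ^ m * fact m powr s"
      using Q \<delta> assms by (intro mult_mono one_le_power ge_one_powr_ge_zero) auto
    then show ?thesis by simp
  qed
  have flat: "B * fact m / \<delta> ^ m * (exp (- (t powr (- 1 / (s - 1))) / 2) / t ^ m)
      \<le> B * (1 + Q / \<delta>) ^ m * fact m powr s" if "t > 0" for m t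
  proof -
    have "exp (- (t powr (- 1 / (s - 1))) / 2) / t ^ m \<le> Q ^ m * fact m powr (s - 1)"
      using inverse_power_times_exp_powr_le[of "1 / (s - 1)" t m] that assms
      by (simp add: Q_def)
    then have "B * fact m / \<delta> ^ m * (exp (- (t powr (- 1 / (s - 1))) / 2) / t ^ m)
        \<le> B * fact m / \<delta> ^ m * (Q ^ m * fact m powr (s - 1))"
      using \<delta> by (intro mult_left_mono) auto
    also have "\<dots> = B * (Q / \<delta>) ^ m * fact m powr s"
      by (simp add: powr_diff power_divide)
    also have "\<dots> \<le> B * (1 + Q / \<delta>) ^ m * fact m powr s"
      using \<delta> Q by (intro mult_left_mono mult_right_mono power_mono) auto
    finally show ?thesis .
  qed
  show thesis
  proof (rule that[of "1 + B" "1 + Q / \<delta>"])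
    show "1 + B > 0" "1 + Q / \<delta> > 0" using \<delta> Q by (auto simp: add_pos_pos)
    fix m and t :: real
    let ?R = "(1 + Q / \<delta>) ^ m * fact m powr s"
    consider "t \<le> 0 \<or> t \<ge> 1" | "0 < t" "t \<le> 1 / 2" | "0 < 1 - t" "1 - t \<le> 1 / 2" by linarith
    then have "cmod (step_deriv s m t) \<le> 1 + B * ?R \<or> cmod (step_deriv s m t) \<le> 1"
    proof cases
      case 1
      then show ?thesis by (auto simp: step_deriv_def)
    next
      case 2
      then have "cmod (step_deriv s m t - (if m = 0 then 1 else 0)) \<le> B * ?R"
        using order_trans[OF near(1) flat] by (simp add: mult.assoc)
      then show ?thesis
        using norm_triangle_ineq2[of "step_deriv s m t" "if m = 0 then 1 else 0"]
        by (auto split: if_splits)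
    next
      case 3
      then have "cmod (step_deriv s m (1 - (1 - t))) \<le> B * ?R"
        using order_trans[OF near(2)[OF 3] flat[OF 3(1)]] by (simp add: mult.assoc)
      then show ?thesis by simp
    qed
    moreover have "0 \<le> B * ?R" using \<delta> one[of m] by simp
    ultimately have "cmod (step_deriv s m t) \<le> ?R + B * ?R"
      using one[of m] by linarith
    then show "cmod (step_deriv s m t) \<le> (1 + B) * (1 + Q / \<delta>) ^ m * fact m powr s"
      by (simp add: algebra_simps)
  qed
qed

lemma has_vector_derivative_0_quadratic:
  fixes f :: "real \<Rightarrow> 'a :: real_normed_vector"
  assumes "e > 0" and "\<And>y. \<bar>y - x\<bar> < e \<Longrightarrow> norm (f y - f x) \<le> K * (y - x)\<^sup>2"
  shows "(f has_vector_derivative 0) (at x)"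
  unfolding has_vector_derivative_def
proof (rule has_derivativeI_sandwich[of e _ _ _ _ "\<lambda>y. K * \<bar>y - x\<bar>"])
  fix y assume y: "y \<noteq> x" "dist y x < e"
  then have "norm (f y - f x) \<le> K * \<bar>y - x\<bar> * \<bar>y - x\<bar>"
    using assms(2)[of y] by (simp add: dist_norm power2_eq_square mult.assoc abs_mult_self_eq)
  then show "norm (f y - f x - (y - x) *\<^sub>R 0) / norm (y - x) \<le> K * \<bar>y - x\<bar>"
    using y by (simp add: divide_le_eq)
next
  show "((\<lambda>y. K * \<bar>y - x\<bar>) \<longlongrightarrow> 0) (at x)"
    by (auto intro!: tendsto_eq_intros)
qed (use assms in auto)

text \<open>
  Only the end points 0 and 1 need an argument beyond holomorphy. There the bound
  \<open>inverse_power_times_exp_powr_le\<close>, used with \<open>m + 2\<close> in place of \<open>m\<close>, shows that the \<open>m\<close>-th derivative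
  approaches its end value quadratically.
\<close>

lemma has_vector_derivative_step_deriv:
  assumes "s > 1"
  shows "(step_deriv s m has_vector_derivative step_deriv s (Suc m) t) (at t)"
proof -
  obtain \<delta> B where \<delta>: "\<delta> > 0" "B > 0"
    and near: "\<And>m t. 0 < t \<Longrightarrow> t \<le> 1 / 2 \<Longrightarrow> cmod (step_deriv s m t - (if m = 0 then 1 else 0))
       \<le> B * fact m / \<delta> ^ m * (exp (- (t powr (- 1 / (s - 1))) / 2) / t ^ m)"
    "\<And>m t. 0 < t \<Longrightarrow> t \<le> 1 / 2 \<Longrightarrow> cmod (step_deriv s m (1 - t))
       \<le> B * fact m / \<delta> ^ m * (exp (- (t powr (- 1 / (s - 1))) / 2) / t ^ m)"
    using step_deriv_near_ends[OF assms] by blast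
  define \<kappa> where "\<kappa> = 1 / (s - 1)"
  have \<kappa>: "\<kappa> > 0" "- 1 / (s - 1) = - \<kappa>" using assms by (auto simp: \<kappa>_def)
  define J where "J = B * fact m / \<delta> ^ m * (((2 / \<kappa>) powr (1 / \<kappa>)) ^ (m + 2) * fact (m + 2) powr (1 / \<kappa>))"
  have J: "J \<ge> 0" using \<delta> by (simp add: J_def)
  have flat: "B * fact m / \<delta> ^ m * (exp (- (d powr (- 1 / (s - 1))) / 2) / d ^ m) \<le> J * d\<^sup>2"
    if "d > 0" for d
  proof -
    have "exp (- (d powr (- \<kappa>)) / 2) / d ^ m = exp (- (d powr (- \<kappa>)) / 2) / d ^ (m + 2) * d\<^sup>2"
      using that by (simp add: power_add power2_eq_square)
    also have "\<dots> \<le> ((2 / \<kappa>) powr (1 / \<kappa>)) ^ (m + 2) * fact (m + 2) powr (1 / \<kappa>) * d\<^sup>2"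
      by (intro mult_right_mono inverse_power_times_exp_powr_le \<kappa> that) auto
    finally show ?thesis
      unfolding J_def \<kappa>(2) using \<delta> by (simp only: mult.assoc) (intro mult_left_mono; simp)
  qed
  consider "0 < t" "t < 1" | "t = 0" | "t = 1" | "t < 0" | "t > 1" by linarith
  then show ?thesis
  proof cases
    case 1
    have "of_real t \<in> step_domain \<kappa>"
    proof -
      obtain \<delta> B where d: "\<delta> > (0::real)" "\<And>t. 0 < t \<Longrightarrow> t \<le> 1 / 2 \<Longrightarrow> cball (of_real t) (\<delta> * t) \<subseteq> step_domain \<kappa>"
        "\<And>t. 0 < t \<Longrightarrow> t \<le> 1 / 2 \<Longrightarrow> cball (of_real (1 - t)) (\<delta> * t) \<subseteq> step_domain \<kappa>"
        using complex_step_disc[OF \<kappa>(1)] by metis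
      show ?thesis
      proof (cases "t \<le> 1 / 2")
        case True
        then show ?thesis using d(1) d(2)[of t] 1 by (auto simp: subset_iff)
      next
        case False
        then show ?thesis using d(1) d(3)[of "1 - t"] 1 by (auto simp: subset_iff)
      qed
    qed
    from has_field_derivative_higher_deriv[OF holomorphic_complex_step open_step_domain this, of m]
    have "((\<lambda>t. (deriv ^^ m) (complex_step \<kappa>) (of_real t)) has_vector_derivative
        (deriv ^^ Suc m) (complex_step \<kappa>) (of_real t)) (at t)"
      by (rule has_vector_derivative_real_field)
    then have "(step_deriv s m has_vector_derivative (deriv ^^ Suc m) (complex_step \<kappa>) (of_real t)) (at t)"
      by (rule has_vector_derivative_transform_within_open[where S = "{0<..<1}"])
         (use 1 in \<open>auto simp: step_deriv_def \<kappa>_def\<close>)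
    then show ?thesis using 1 by (simp add: step_deriv_def \<kappa>_def)
  next
    case 2
    have "(step_deriv s m has_vector_derivative 0) (at t)"
    proof (rule has_vector_derivative_0_quadratic[of "1 / 2" _ _ J])
      fix y :: real assume y: "\<bar>y - t\<bar> < 1 / 2"
      have e: "step_deriv s m t = (if m = 0 then 1 else 0)" using 2 by (simp add: step_deriv_def)
      show "cmod (step_deriv s m y - step_deriv s m t) \<le> J * (y - t)\<^sup>2"
      proof (cases "y > 0")
        case True
        then show ?thesis
          unfolding e using order_trans[OF near(1)[of y m] flat[of y]] y 2 by simp
      next
        case False
        then show ?thesis using J 2 by (simp add: step_deriv_def)
      qed
    qed simp
    then show ?thesis using 2 by (simp add: step_deriv_def)
  next
    case 3
    have "(step_deriv s m has_vector_derivative 0) (at t)"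
    proof (rule has_vector_derivative_0_quadratic[of "1 / 2" _ _ J])
      fix y :: real assume y: "\<bar>y - t\<bar> < 1 / 2"
      have e: "step_deriv s m t = 0" using 3 by (simp add: step_deriv_def)
      show "cmod (step_deriv s m y - step_deriv s m t) \<le> J * (y - t)\<^sup>2"
      proof (cases "y < 1")
        case True
        then show ?thesis
          unfolding e using order_trans[OF near(2)[of "1 - y" m] flat[of "1 - y"]] y 3
          by (simp add: power2_commute)
      next
        case False
        then show ?thesis using J 3 by (simp add: step_deriv_def)
      qed
    qed simp
    then show ?thesis using 3 by (simp add: step_deriv_def)
  next
    case 4
    have "(step_deriv s m has_vector_derivative 0) (at t)"
      by (rule has_vector_derivative_transform_within_open[OF has_vector_derivative_const[of "if m = 0 then 1 else 0"], of "{..<0}"])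
         (use 4 in \<open>auto simp: step_deriv_def\<close>)
    then show ?thesis using 4 by (simp add: step_deriv_def)
  next
    case 5
    have "(step_deriv s m has_vector_derivative 0) (at t)"
      by (rule has_vector_derivative_transform_within_open[OF has_vector_derivative_const[of 0], of "{1<..}"])
         (use 5 in \<open>auto simp: step_deriv_def\<close>)
    then show ?thesis using 5 by (simp add: step_deriv_def)
  qed
qed

section \<open>Power series cut off by the step function\<close>

definition stepped_power_series ::
  "real \<Rightarrow> real \<Rightarrow> real \<Rightarrow> (nat \<Rightarrow> complex) \<Rightarrow> real \<Rightarrow> complex" where
  "stepped_power_series \<tau> s R a t =
     of_real (step_fun s ((t - \<tau>) / R)) * (\<Sum>k. a k * of_real (t - \<tau>) ^ k)"

text \<open>
  The two-sided derivatives exist at every \<open>t \<ge> \<tau>\<close> because the power series converges on \<open>(-r, r)\<close>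
  and the step factor vanishes with all its derivatives from \<open>\<tau> + R < \<tau> + r\<close> on; the two regions
  overlap, so nothing has to be glued at \<open>\<tau> + R\<close>.
\<close>

lemma stepped_power_series_gevrey:
  assumes "s > 1" "0 < R" "R < r"
  obtains B M where "B > 0" "M > 0"
    "\<And>a D. (\<And>k. cmod (a k) \<le> D / r ^ k) \<Longrightarrow>
       \<exists>Y. Y 0 = stepped_power_series \<tau> s R a \<and>
         (\<forall>i. \<forall>t\<ge>\<tau>. (Y i has_vector_derivative Y (Suc i) t) (at t) \<and>
                    cmod (Y i t) \<le> D * (B * M ^ i * fact i powr s))"
proof -
  obtain A K where A: "A > 0" "K > 0"
    and step: "\<And>m t. cmod (step_deriv s m t) \<le> A * K ^ m * fact m powr s"
    using step_deriv_gevrey[OF assms(1)] by blast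
  define P where "P = 2 * r / (r - R)"
  define L where "L = 2 / (r - R)"
  have P: "P > 0" "L > 0" using assms by (auto simp: P_def L_def)
  define F where "F = (\<lambda>m t. (1 / R) ^ m *\<^sub>R step_deriv s m ((t - \<tau>) / R))"
  have F_deriv: "(F m has_vector_derivative F (Suc m) t) (at t)" for m t
  proof -
    have "((\<lambda>t. (t - \<tau>) / R) has_vector_derivative 1 / R) (at t)"
      using assms by (auto intro!: derivative_eq_intros simp flip: has_real_derivative_iff_has_vector_derivative)
    from vector_diff_chain_at[OF this has_vector_derivative_step_deriv[OF assms(1), of m]]
    have "((\<lambda>t. step_deriv s m ((t - \<tau>) / R)) has_vector_derivative
        (1 / R) *\<^sub>R step_deriv s (Suc m) ((t - \<tau>) / R)) (at t)"
      by (simp add: o_def)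
    then have "(F m has_vector_derivative (1 / R) ^ m *\<^sub>R (1 / R) *\<^sub>R step_deriv s (Suc m) ((t - \<tau>) / R)) (at t)"
      unfolding F_def by (rule bounded_linear.has_vector_derivative[OF bounded_linear_scaleR_right])
    then show ?thesis by (simp add: F_def mult.commute)
  qed
  have F_bound: "cmod (F m t) \<le> A * (K / R) ^ m * fact m powr s" for m t
  proof -
    have "cmod (F m t) = (1 / R) ^ m * cmod (step_deriv s m ((t - \<tau>) / R))"
      using assms by (simp add: F_def)
    also have "\<dots> \<le> (1 / R) ^ m * (A * K ^ m * fact m powr s)"
      using assms by (intro mult_left_mono step) auto
    finally show ?thesis by (simp add: power_divide mult_ac)
  qed
  have F_zero: "F m t = 0" if "t > \<tau> + R" for m t
    using that assms by (simp add: F_def step_deriv_def field_simps)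
  show thesis
  proof (rule that[of "A * P" "L + K / R"])
    show "A * P > 0" "L + K / R > 0" using A P assms by (auto intro: add_pos_pos)
    fix a :: "nat \<Rightarrow> complex" and D assume a: "\<And>k. cmod (a k) \<le> D / r ^ k"
    have D: "D \<ge> 0" using order_trans[OF norm_ge_zero a[of 0]] by simp
    let ?f = "\<lambda>z. \<Sum>k. a k * z ^ k"
    define G where "G = (\<lambda>j t. (deriv ^^ j) ?f (of_real (t - \<tau>)))"
    have G_deriv: "(G j has_vector_derivative G (Suc j) t) (at t)" if "\<tau> \<le> t" "t < \<tau> + r" for j t
    proof -
      have hol: "?f holomorphic_on ball 0 r"
        using assms by (intro holomorphic_power_series_majorised[OF a]) auto
      have "complex_of_real (t - \<tau>) \<in> ball 0 r"
        using that by (simp del: of_real_diff)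
      from has_field_derivative_higher_deriv[OF hol open_ball this, of j]
      have "((\<lambda>u. (deriv ^^ j) ?f (of_real u)) has_vector_derivative G (Suc j) t) (at (t - \<tau>))"
        unfolding G_def by (rule has_vector_derivative_real_field)
      moreover have "((\<lambda>t. t - \<tau>) has_vector_derivative 1) (at t)"
        by (auto intro!: derivative_eq_intros simp flip: has_real_derivative_iff_has_vector_derivative)
      ultimately have "((\<lambda>u. (deriv ^^ j) ?f (of_real u)) \<circ> (\<lambda>t. t - \<tau>) has_vector_derivative 1 *\<^sub>R G (Suc j) t) (at t)"
        by (intro vector_diff_chain_at)
      then show ?thesis by (simp add: G_def o_def)
    qed
    define Y where "Y = leibniz_sum F G"
    have Y_zero: "Y i t = 0" if "t > \<tau> + R" for i t
      using F_zero[OF that] by (simp add: Y_def leibniz_sum_def)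
    have "(Y i has_vector_derivative Y (Suc i) t) (at t)" if "\<tau> \<le> t" for i t
    proof (cases "t < \<tau> + r")
      case True
      then show ?thesis
        unfolding Y_def using that by (intro has_vector_derivative_leibniz_sum F_deriv G_deriv)
    next
      case False
      then have t: "t > \<tau> + R" using assms by simp
      have "(Y i has_vector_derivative 0) (at t)"
        by (rule has_vector_derivative_transform_within_open[OF has_vector_derivative_const[of 0], of "{\<tau> + R<..}"])
           (use t Y_zero in auto)
      then show ?thesis using Y_zero[OF t] by simp
    qed
    moreover have "cmod (Y i t) \<le> D * (A * P * (L + K / R) ^ i * fact i powr s)" if "\<tau> \<le> t" for i t
    proof (cases "t \<le> \<tau> + R")
      case True
      have "cmod (G m t) \<le> D * P * L ^ m * fact m" for m
        unfolding G_def P_def L_def using True that assms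
        by (intro higher_deriv_power_series_bound a) (simp_all del: of_real_diff)
      then have "cmod (Y i t) \<le> A * (D * P) * (L + K / R) ^ i * fact i powr s"
        unfolding Y_def using A D P assms by (intro norm_leibniz_sum_le F_bound) auto
      then show ?thesis by (simp add: mult_ac)
    next
      case False
      then show ?thesis using Y_zero D A P assms by simp
    qed
    moreover have "Y 0 = stepped_power_series \<tau> s R a"
      by (rule ext) (simp add: Y_def leibniz_sum_def F_def G_def stepped_power_series_def step_deriv_0)
    ultimately show "\<exists>Y. Y 0 = stepped_power_series \<tau> s R a \<and>
         (\<forall>i. \<forall>t\<ge>\<tau>. (Y i has_vector_derivative Y (Suc i) t) (at t) \<and>
            cmod (Y i t) \<le> D * (A * P * (L + K / R) ^ i * fact i powr s))"
      by blast
  qed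
qed

lemma stepped_power_series_diff:
  assumes a: "\<And>k. cmod (a k) \<le> D / r ^ k" and b: "\<And>k. cmod (b k) \<le> D' / r ^ k"
    and "0 < R" "R < r" "\<tau> \<le> t"
  shows "stepped_power_series \<tau> s R (\<lambda>k. a k - b k) t =
    stepped_power_series \<tau> s R a t - stepped_power_series \<tau> s R b t"
proof (cases "t - \<tau> < r")
  case True
  have u: "cmod (of_real (t - \<tau>)) < r" using True assms by (simp del: of_real_diff)
  have "r > 0" using assms by simp
  note sums = power_series_majorised(1)[OF a this u] power_series_majorised(1)[OF b this u]
  show ?thesis
    using suminf_diff[OF sums] by (simp add: stepped_power_series_def algebra_simps)
next
  case False
  then have "(t - \<tau>) / R \<ge> 1" using assms by (simp add: field_simps)
  then show ?thesis by (simp add: stepped_power_series_def step_fun_def Let_def)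
qed

section \<open>Fourier coefficients and the coefficients of the flat output\<close>

lemma norm_L2_01_nonneg: "0 \<le> norm_L2_01 f"
  by (simp add: norm_L2_01_def)

text \<open>
  The coefficients are bounded by the \<open>L\<^sup>1\<close> norm, which is at most the \<open>L\<^sup>2\<close> norm on an interval of
  length 1: take \<open>\<epsilon> = \<parallel>f\<parallel>\<close> in \<open>L2_01_bound\<close>.
\<close>

lemma norm_cos_coeff_le:
  assumes f: "f \<in> L2_01"
  shows "cmod (cos_coeff f n) \<le> 2 * norm_L2_01 f"
proof -
  have I: "integrable M01 f" using L2_01_bound(1)[OF f, of 1] by simp
  have L1: "(LINT x|M01. cmod (f x)) \<le> norm_L2_01 f"
  proof (cases "norm_L2_01 f = 0")
    case True
    have "(LINT x|M01. cmod (f x)) \<le> 0"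
    proof (rule field_le_epsilon)
      fix e :: real assume "0 < e"
      then show "(LINT x|M01. cmod (f x)) \<le> 0 + e"
        using L2_01_bound(2)[OF f, of "2 * e"] True by simp
    qed
    then show ?thesis using True by simp
  next
    case False
    then have "norm_L2_01 f > 0" using norm_L2_01_nonneg[of f] by simp
    from L2_01_bound(2)[OF f this] show ?thesis
      using False by (simp add: power2_eq_square)
  qed
  have "cmod (LINT x|M01. cos (real n * pi * x) *\<^sub>R f x) \<le> (LINT x|M01. cmod (f x))"
    by (rule order_trans[OF integral_norm_bound integral_mono'])
       (use I in \<open>auto simp: mult_left_le_one_le\<close>)
  moreover have "(if n = 0 then 1 / sqrt 2 else sqrt 2) \<le> 2"
    using sqrt2_less_2 by (auto simp: divide_le_eq intro: order_trans[of 1 "sqrt 2"])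
  ultimately show ?thesis
    using L1 norm_L2_01_nonneg[of f] unfolding cos_coeff_def norm_scaleR
    by (intro mult_mono) auto
qed

text \<open>
  \<open>(n + m)\<^sup>2 \<ge> n + m\<^sup>2\<close> for natural numbers, which compares the sum with a geometric series.
\<close>

lemma gaussian_tail:
  fixes \<beta> :: real
  assumes "\<beta> > 0"
  shows "summable (\<lambda>n. exp (- \<beta> * (real n)\<^sup>2))"
    and "(\<Sum>n. exp (- \<beta> * (real n)\<^sup>2)) \<le> 1 / (1 - exp (- \<beta>))"
    and "(\<Sum>n. exp (- \<beta> * (real (n + Suc N))\<^sup>2)) \<le> 1 / (1 - exp (- \<beta>)) * exp (- \<beta> * (real N)\<^sup>2)"
proof -
  have le: "exp (- \<beta> * (real (n + m))\<^sup>2) \<le> exp (- \<beta> * (real m)\<^sup>2) * exp (- \<beta>) ^ n" for n m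
  proof -
    have "real n \<le> (real n)\<^sup>2" by (cases n) (auto simp: power2_eq_square)
    then have "real n + (real m)\<^sup>2 \<le> (real n)\<^sup>2 + (real m)\<^sup>2 + 2 * real n * real m"
      by (simp only: add_mono add_increasing2 mult_nonneg_nonneg of_nat_0_le_iff zero_le_numeral order_refl)
    then have "real n + (real m)\<^sup>2 \<le> (real (n + m))\<^sup>2"
      by (simp only: of_nat_add power2_sum)
    then have "\<beta> * (real n + (real m)\<^sup>2) \<le> \<beta> * (real (n + m))\<^sup>2"
      using assms by (intro mult_left_mono) auto
    then have "exp (- \<beta> * (real (n + m))\<^sup>2) \<le> exp (- \<beta> * (real m)\<^sup>2 + real n * - \<beta>)"
      by (simp add: algebra_simps)
    then show ?thesis by (simp only: exp_add exp_of_nat_mult)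
  qed
  have geo: "summable (\<lambda>n. exp (- \<beta>) ^ n)" "(\<Sum>n. exp (- \<beta>) ^ n) = 1 / (1 - exp (- \<beta>))"
    using assms by (auto intro!: summable_geometric suminf_geometric)
  show S: "summable (\<lambda>n. exp (- \<beta> * (real n)\<^sup>2))"
    by (rule summable_comparison_test'[OF geo(1), of 0]) (use le[of _ 0] in auto)
  show "(\<Sum>n. exp (- \<beta> * (real n)\<^sup>2)) \<le> 1 / (1 - exp (- \<beta>))"
    unfolding geo(2)[symmetric] by (rule suminf_le[OF _ S geo(1)]) (use le[of _ 0] in auto)
  have "(\<Sum>n. exp (- \<beta> * (real (n + Suc N))\<^sup>2)) \<le> (\<Sum>n. exp (- \<beta> * (real (Suc N))\<^sup>2) * exp (- \<beta>) ^ n)"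
    by (rule suminf_le[OF le summable_ignore_initial_segment[OF S] summable_mult[OF geo(1)]])
  also have "\<dots> = 1 / (1 - exp (- \<beta>)) * exp (- \<beta> * (real (Suc N))\<^sup>2)"
    by (simp only: suminf_mult[OF geo(1)] geo(2)) (rule mult.commute)
  also have "\<dots> \<le> 1 / (1 - exp (- \<beta>)) * exp (- \<beta> * (real N)\<^sup>2)"
    using assms by (intro mult_left_mono) (auto simp: power2_eq_square intro!: mult_mono)
  finally show "(\<Sum>n. exp (- \<beta> * (real (n + Suc N))\<^sup>2)) \<le> 1 / (1 - exp (- \<beta>)) * exp (- \<beta> * (real N)\<^sup>2)" .
qed

text \<open>
  The heat factor is split as \<open>exp (- n\<^sup>2 * pi\<^sup>2 * \<rho>) * exp (- \<beta> * n\<^sup>2)\<close> with \<open>\<beta> = pi\<^sup>2 * (\<tau> - \<rho>)\<close>: the first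
  factor turns \<open>(n\<^sup>2 * pi\<^sup>2) ^ k\<close> into \<open>k! / \<rho> ^ k\<close>, the second one sums over \<open>n\<close>.
\<close>

lemma y_coeff_bounds:
  assumes "0 < \<rho>" "\<rho> < \<tau>"
  obtains A \<beta> where "A > 0" "\<beta> > 0"
    "\<And>f k. f \<in> L2_01 \<Longrightarrow> cmod (y_coeff \<tau> f k) / fact k \<le> A * norm_L2_01 f / \<rho> ^ k"
    "\<And>f k N. f \<in> L2_01 \<Longrightarrow> cmod (y_coeff \<tau> f k - y_coeff_trunc \<tau> N f k) / fact k
       \<le> A * norm_L2_01 f * exp (- \<beta> * (real N)\<^sup>2) / \<rho> ^ k"
proof -
  define \<beta> where "\<beta> = pi\<^sup>2 * (\<tau> - \<rho>)"
  have \<beta>: "\<beta> > 0" using assms by (simp add: \<beta>_def)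
  define S where "S = 1 / (1 - exp (- \<beta>))"
  have S: "S > 0" using \<beta> by (simp add: S_def)
  let ?A = "sqrt 2 * 2 * S"
  have main: "cmod (y_coeff \<tau> f k) / fact k \<le> ?A * norm_L2_01 f / \<rho> ^ k \<and>
      cmod (y_coeff \<tau> f k - y_coeff_trunc \<tau> N f k) / fact k
         \<le> ?A * norm_L2_01 f * exp (- \<beta> * (real N)\<^sup>2) / \<rho> ^ k" if f: "f \<in> L2_01" for f k N
  proof -
    define c where "c = (\<lambda>n. (exp (- ((real n)\<^sup>2 * pi\<^sup>2 * \<tau>)) * real n ^ (2 * k)) *\<^sub>R cos_coeff f n)"
    define Q where "Q = fact k / (pi\<^sup>2 * \<rho>) ^ k * (2 * norm_L2_01 f)"
    have Q: "Q \<ge> 0" using assms norm_L2_01_nonneg[of f] by (simp add: Q_def)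
    have c: "cmod (c n) \<le> Q * exp (- \<beta> * (real n)\<^sup>2)" for n
    proof -
      define x where "x = (real n)\<^sup>2 * pi\<^sup>2 * \<rho>"
      have "x ^ k \<le> fact k * exp x"
        using assms by (intro power_le_fact_mult_exp) (simp add: x_def)
      moreover have "real n ^ (2 * k) * (pi\<^sup>2 * \<rho>) ^ k = x ^ k"
        unfolding x_def power_mult[of "real n" 2 k] power_mult_distrib by (simp only: mult_ac)
      ultimately have "real n ^ (2 * k) * (pi\<^sup>2 * \<rho>) ^ k \<le> fact k * exp x"
        by simp
      then have "real n ^ (2 * k) \<le> fact k / (pi\<^sup>2 * \<rho>) ^ k * exp x"
        using assms by (simp add: pos_le_divide_eq)
      then have "exp (- ((real n)\<^sup>2 * pi\<^sup>2 * \<tau>)) * real n ^ (2 * k)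
          \<le> exp (- ((real n)\<^sup>2 * pi\<^sup>2 * \<tau>)) * (fact k / (pi\<^sup>2 * \<rho>) ^ k * exp x)"
        by (intro mult_left_mono) auto
      also have "\<dots> = fact k / (pi\<^sup>2 * \<rho>) ^ k * exp (- ((real n)\<^sup>2 * pi\<^sup>2 * \<tau>) + x)"
        by (simp only: exp_add mult_ac)
      also have "- ((real n)\<^sup>2 * pi\<^sup>2 * \<tau>) + x = - \<beta> * (real n)\<^sup>2"
        by (simp add: x_def \<beta>_def algebra_simps)
      finally have "exp (- ((real n)\<^sup>2 * pi\<^sup>2 * \<tau>)) * real n ^ (2 * k)
          \<le> fact k / (pi\<^sup>2 * \<rho>) ^ k * exp (- \<beta> * (real n)\<^sup>2)" .
      then have "exp (- ((real n)\<^sup>2 * pi\<^sup>2 * \<tau>)) * real n ^ (2 * k) * cmod (cos_coeff f n)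
          \<le> fact k / (pi\<^sup>2 * \<rho>) ^ k * exp (- \<beta> * (real n)\<^sup>2) * (2 * norm_L2_01 f)"
        by (rule mult_mono[OF _ norm_cos_coeff_le[OF f]]) (use assms in auto)
      then show ?thesis by (simp add: c_def Q_def mult_ac)
    qed
    note g = gaussian_tail[OF \<beta>, folded S_def]
    have sQ: "summable (\<lambda>n. Q * exp (- \<beta> * (real n)\<^sup>2))"
      by (intro summable_mult g)
    have sc: "summable c"
      by (rule summable_comparison_test'[OF sQ, of 0]) (rule c)
    have scale: "cmod ((sqrt 2 * (- (pi\<^sup>2)) ^ k) *\<^sub>R v) / fact k \<le> ?A * norm_L2_01 f * e / \<rho> ^ k"
      if "cmod v \<le> Q * (S * e)" for v e
    proof -
      have "cmod ((sqrt 2 * (- (pi\<^sup>2)) ^ k) *\<^sub>R v) / fact k = sqrt 2 * (pi\<^sup>2) ^ k * cmod v / fact k"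
        by (simp add: abs_mult power_abs)
      also have "\<dots> \<le> sqrt 2 * (pi\<^sup>2) ^ k * (Q * (S * e)) / fact k"
        using that by (intro divide_right_mono mult_left_mono) auto
      also have "\<dots> = ?A * norm_L2_01 f * e / \<rho> ^ k"
        using assms by (simp add: Q_def power_mult_distrib field_simps)
      finally show ?thesis .
    qed
    have "cmod (suminf c) \<le> (\<Sum>n. Q * exp (- \<beta> * (real n)\<^sup>2))"
      by (rule norm_suminf_le[OF c sQ])
    also have "\<dots> \<le> Q * (S * 1)"
      using mult_left_mono[OF g(2) Q] by (simp only: suminf_mult[OF g(1)] mult_1_right)
    finally have "cmod (y_coeff \<tau> f k) / fact k \<le> ?A * norm_L2_01 f * 1 / \<rho> ^ k"
      unfolding y_coeff_def c_def[symmetric] by (rule scale)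
    moreover have "cmod (y_coeff \<tau> f k - y_coeff_trunc \<tau> N f k) / fact k
         \<le> ?A * norm_L2_01 f * exp (- \<beta> * (real N)\<^sup>2) / \<rho> ^ k"
    proof -
      have "cmod (\<Sum>n. c (n + Suc N)) \<le> (\<Sum>n. Q * exp (- \<beta> * (real (n + Suc N))\<^sup>2))"
        by (rule norm_suminf_le[OF c]) (rule summable_ignore_initial_segment[OF sQ])
      also have "\<dots> \<le> Q * (S * exp (- \<beta> * (real N)\<^sup>2))"
        using mult_left_mono[OF g(3) Q]
        by (simp only: suminf_mult[OF summable_ignore_initial_segment[OF g(1)]])
      finally have "cmod (\<Sum>n. c (n + Suc N)) \<le> Q * (S * exp (- \<beta> * (real N)\<^sup>2))" .
      moreover have "suminf c - sum c {..N} = (\<Sum>n. c (n + Suc N))"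
        using suminf_split_initial_segment[OF sc, of "Suc N"] by (simp add: lessThan_Suc_atMost)
      ultimately have "cmod (suminf c - sum c {..N}) \<le> Q * (S * exp (- \<beta> * (real N)\<^sup>2))"
        by simp
      from scale[OF this] show ?thesis
        by (simp add: y_coeff_def y_coeff_trunc_def c_def scaleR_diff_right)
    qed
    ultimately show ?thesis by simp
  qed
  show thesis
    by (rule that[of ?A \<beta>]) (use main S \<beta> in auto)
qed

lemma flat_output_eq_stepped_power_series:
  assumes "0 < R"
  shows "flat_output \<tau> s R f = stepped_power_series \<tau> s R (\<lambda>k. y_coeff \<tau> f k / fact k)"
proof
  fix t
  show "flat_output \<tau> s R f t = stepped_power_series \<tau> s R (\<lambda>k. y_coeff \<tau> f k / fact k) t"
  proof (cases "t \<le> \<tau> + R")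
    case True
    then show ?thesis
      by (simp add: flat_output_def stepped_power_series_def scaleR_conv_of_real mult.commute)
  next
    case False
    then have "(t - \<tau>) / R \<ge> 1" using assms by (simp add: field_simps)
    then show ?thesis
      using False by (simp add: flat_output_def stepped_power_series_def step_fun_def Let_def)
  qed
qed

lemma flat_output_trunc_eq_stepped_power_series:
  "flat_output_trunc \<tau> s R K N f =
     stepped_power_series \<tau> s R (\<lambda>k. if k \<le> K then y_coeff_trunc \<tau> N f k / fact k else 0)"
proof
  fix t
  have "(\<Sum>k. (if k \<le> K then y_coeff_trunc \<tau> N f k / fact k else 0) * complex_of_real (t - \<tau>) ^ k)
      = (\<Sum>k\<le>K. (if k \<le> K then y_coeff_trunc \<tau> N f k / fact k else 0) * complex_of_real (t - \<tau>) ^ k)"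
    by (intro suminf_finite) auto
  then show "flat_output_trunc \<tau> s R K N f t =
     stepped_power_series \<tau> s R (\<lambda>k. if k \<le> K then y_coeff_trunc \<tau> N f k / fact k else 0) t"
    by (simp add: flat_output_trunc_def stepped_power_series_def scaleR_conv_of_real mult.commute)
qed

section \<open>The truncation error\<close>

lemma norm_Linf_01_le:
  assumes "f \<in> borel_measurable M01" "\<And>x. 0 < x \<Longrightarrow> x < 1 \<Longrightarrow> cmod (f x) \<le> B"
  shows "norm_Linf_01 f \<le> ereal B"
  unfolding norm_Linf_01_def
proof (rule esssup_I)
  show "(\<lambda>x. ereal (cmod (f x))) \<in> borel_measurable M01"
    using assms(1) by measurable
  show "AE x in M01. ereal (cmod (f x)) \<le> ereal B"
    using assms(2) by (intro AE_I2) (simp add: space_restrict_space)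
qed

lemma measurable_theta_diff:
  "(\<lambda>x. theta T \<tau> s R f t x - theta_trunc T \<tau> s R I K N f t x) \<in> borel_measurable M01"
proof -
  have [measurable]: "(\<lambda>x::real. x) \<in> borel_measurable M01"
    by (intro borel_measurable_integrable integrable_M01_cont continuous_intros)
  show ?thesis
    unfolding theta_def theta_trunc_def by measurable
qed

lemma series_truncation_error:
  fixes w :: "nat \<Rightarrow> real" and y z :: "nat \<Rightarrow> complex"
  assumes w: "summable w" "\<And>i. 0 \<le> w i"
    and y: "\<And>i. cmod (y i) \<le> D * w i" and yz: "\<And>i. cmod (y i - z i) \<le> D' * w i"
    and "0 \<le> D'"
  shows "cmod ((\<Sum>i. y i) - (\<Sum>i\<le>n. z i)) \<le> D' * suminf w + D * (\<Sum>i. w (i + Suc n))"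
proof -
  have sy: "summable y"
    by (rule summable_comparison_test'[OF summable_mult[OF w(1)]]) (rule y)
  have "(\<Sum>i. y i) - (\<Sum>i\<le>n. z i) = (\<Sum>i\<le>n. y i - z i) + (\<Sum>i. y (i + Suc n))"
    using suminf_split_initial_segment[OF sy, of "Suc n"] by (simp add: lessThan_Suc_atMost sum_subtractf)
  moreover have "cmod (\<Sum>i\<le>n. y i - z i) \<le> D' * suminf w"
  proof -
    have "cmod (\<Sum>i\<le>n. y i - z i) \<le> (\<Sum>i\<le>n. D' * w i)"
      by (intro sum_norm_le yz)
    also have "\<dots> \<le> D' * suminf w"
      unfolding sum_distrib_left[symmetric] using assms by (intro mult_left_mono sum_le_suminf) auto
    finally show ?thesis .
  qed
  moreover have "cmod (\<Sum>i. y (i + Suc n)) \<le> D * (\<Sum>i. w (i + Suc n))"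
    using norm_suminf_le[OF y summable_ignore_initial_segment[OF summable_mult[OF w(1)]], of "Suc n"]
    by (simp only: suminf_mult[OF summable_ignore_initial_segment[OF w(1)]])
  ultimately show ?thesis
    by (simp only: norm_triangle_mono)
qed

theorem theorem5:
  fixes T \<tau> s R' :: real
  assumes "T > 0" and "\<tau> \<in> {0<..<T}" and "s \<in> {1<..<2}"
    and "0 < R'" and "R' < \<tau>" and "R' \<le> T - \<tau>"
  shows "\<exists>C C\<^sub>1 C\<^sub>2 C\<^sub>3 :: real. C > 0 \<and> C\<^sub>1 > 0 \<and> C\<^sub>2 > 0 \<and> C\<^sub>3 > 0 \<and>
    (\<forall>\<theta>\<^sub>0 \<in> L2_01. \<forall>ib kb nb :: nat. \<forall>t \<in> {\<tau>..T}.
      norm_Linf_01 (\<lambda>x. theta T \<tau> s R' \<theta>\<^sub>0 t x - theta_trunc T \<tau> s R' ib kb nb \<theta>\<^sub>0 t x)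
        \<le> ereal (C * (exp (- C\<^sub>1 * real ib * ln (real ib)) + exp (- C\<^sub>2 * real kb)
                      + exp (- C\<^sub>3 * (real nb)\<^sup>2)) * norm_L2_01 \<theta>\<^sub>0))"
proof -
  \<comment> \<open>The gap below \<open>\<tau>\<close> gives the decay in \<open>N\<close>, the gap from \<open>r\<close> to \<open>\<rho>\<close> the decay in \<open>K\<close>,
      and the gap above \<open>R'\<close> the radius for the Cauchy estimates.\<close>
  obtain \<rho> where \<rho>: "R' < \<rho>" "\<rho> < \<tau>" using dense[OF \<open>R' < \<tau>\<close>] by blast
  obtain r where r: "R' < r" "r < \<rho>" using dense[OF \<rho>(1)] by blast
  have pos: "0 < r" "0 < \<rho>" "\<tau> < T" "1 < s" "s < 2" using assms \<rho> r by auto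
  obtain A \<beta> where A: "A > 0" "\<beta> > 0"
    and coeff: "\<And>f k. f \<in> L2_01 \<Longrightarrow> cmod (y_coeff \<tau> f k) / fact k \<le> A * norm_L2_01 f / \<rho> ^ k"
    and coeff_diff: "\<And>f k N. f \<in> L2_01 \<Longrightarrow> cmod (y_coeff \<tau> f k - y_coeff_trunc \<tau> N f k) / fact k
       \<le> A * norm_L2_01 f * exp (- \<beta> * (real N)\<^sup>2) / \<rho> ^ k"
    using y_coeff_bounds[OF pos(2) \<rho>(2)] by metis
  obtain B M where BM: "B > 0" "M > 0"
    and gevrey: "\<And>a D. (\<And>k. cmod (a k) \<le> D / r ^ k) \<Longrightarrow>
       \<exists>Y. Y 0 = stepped_power_series \<tau> s R' a \<and>
         (\<forall>i. \<forall>t\<ge>\<tau>. (Y i has_vector_derivative Y (Suc i) t) (at t) \<and>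
                    cmod (Y i t) \<le> D * (B * M ^ i * fact i powr s))"
    using stepped_power_series_gevrey[OF pos(4) \<open>0 < R'\<close> r(1), of \<tau>] by metis
  define w where "w = (\<lambda>i. M ^ i * fact i powr s / fact (2 * i))"
  have w: "summable w" "\<And>i. w i \<ge> 0"
    using gevrey_weight_tail(1)[OF BM(2) pos(5)] BM by (auto simp: w_def)
  obtain W where W: "W > 0"
    "\<And>n. (\<Sum>i. w (i + Suc n)) \<le> W * exp (- ((2 - s) / 2) * real n * ln (real n))"
    using gevrey_weight_tail(2)[OF BM(2) pos(5)] unfolding w_def by blast
  define q where "q = r / \<rho>"
  have q: "0 < q" "q < 1" using r pos by (auto simp: q_def)
  have nth: "nth_deriv_on {\<tau>..T} i f t = Y i t"
    if "\<And>i t. \<tau> \<le> t \<Longrightarrow> (Y i has_vector_derivative Y (Suc i) t) (at t)"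
      "\<And>t. \<tau> \<le> t \<Longrightarrow> f t = Y 0 t" "t \<in> {\<tau>..T}" for Y f i t
    using that pos by (intro nth_deriv_on_eq) (auto intro: has_vector_derivative_at_within)

  have bound: "cmod (theta T \<tau> s R' f t x - theta_trunc T \<tau> s R' I K N f t x)
     \<le> A * B * (suminf w + W) * (exp (- ((2 - s) / 2) * real I * ln (real I)) + exp (- (- ln q) * real K)
                      + exp (- \<beta> * (real N)\<^sup>2)) * norm_L2_01 f"
    if f: "f \<in> L2_01" and t: "t \<in> {\<tau>..T}" and x: "0 < x" "x < 1" for f I K N t x
  proof -
    define e1 where "e1 = exp (- ((2 - s) / 2) * real I * ln (real I))"
    define e2 where "e2 = exp (- (- ln q) * real K)"
    define e3 where "e3 = exp (- \<beta> * (real N)\<^sup>2)"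
    have e: "e1 > 0" "e2 > 0" "e3 > 0" by (simp_all add: e1_def e2_def e3_def)
    have e2: "e2 = q ^ K" using q by (simp add: e2_def exp_of_nat2_mult)
    define D where "D = A * norm_L2_01 f"
    have D: "D \<ge> 0" using A norm_L2_01_nonneg[of f] by (simp add: D_def)
    define a where "a = (\<lambda>k. y_coeff \<tau> f k / fact k)"
    define b where "b = (\<lambda>k. if k \<le> K then y_coeff_trunc \<tau> N f k / fact k else 0)"
    have \<rho>r: "1 / \<rho> ^ k \<le> 1 / r ^ k" for k
      using r pos by (intro divide_left_mono power_mono) auto
    have a\<rho>: "cmod (a k) \<le> D / \<rho> ^ k" for k
      using coeff[OF f, of k] by (simp add: a_def D_def norm_divide)
    have a: "cmod (a k) \<le> D / r ^ k" for k
      using order_trans[OF a\<rho>[of k]] mult_left_mono[OF \<rho>r[of k] D] by simp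
    have ab: "cmod (a k - b k) \<le> D * (e2 + e3) / r ^ k" for k
    proof (cases "k \<le> K")
      case True
      have "cmod (a k - b k) \<le> D * e3 * (1 / \<rho> ^ k)"
        using coeff_diff[OF f, of k N] True
        by (simp add: a_def b_def D_def e3_def norm_divide flip: diff_divide_distrib)
      also have "\<dots> \<le> D * (e2 + e3) * (1 / r ^ k)"
        using D e \<rho>r pos by (intro mult_mono) auto
      finally show ?thesis by simp
    next
      case False
      have "cmod (a k - b k) \<le> D / \<rho> ^ k"
        using a\<rho> False by (simp add: b_def)
      also have "\<dots> = D * q ^ k / r ^ k"
        using pos by (simp add: q_def power_divide)
      also have "\<dots> \<le> D * (e2 + e3) / r ^ k"
      proof (intro divide_right_mono mult_left_mono)
        have "q ^ k \<le> e2"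
          unfolding e2 using q False by (intro power_decreasing) auto
        then show "q ^ k \<le> e2 + e3" using e by simp
      qed (use D pos in auto)
      finally show ?thesis .
    qed
    \<comment> \<open>From this crude bound only convergence and differentiability of the truncated output are needed.\<close>
    have b: "cmod (b k) \<le> (D + D * (e2 + e3)) / r ^ k" for k
      using norm_triangle_ineq4[of "a k" "a k - b k"] a[of k] ab[of k]
      by (simp add: add_divide_distrib)
    obtain Y where Y: "Y 0 = stepped_power_series \<tau> s R' a"
      "\<And>i t. \<tau> \<le> t \<Longrightarrow> (Y i has_vector_derivative Y (Suc i) t) (at t)"
      "\<And>i t. \<tau> \<le> t \<Longrightarrow> cmod (Y i t) \<le> D * (B * M ^ i * fact i powr s)"
      using gevrey[OF a] by metis
    obtain Z where Z: "Z 0 = stepped_power_series \<tau> s R' b"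
      "\<And>i t. \<tau> \<le> t \<Longrightarrow> (Z i has_vector_derivative Z (Suc i) t) (at t)"
      using gevrey[OF b] by metis
    obtain V where V: "V 0 = stepped_power_series \<tau> s R' (\<lambda>k. a k - b k)"
      "\<And>i t. \<tau> \<le> t \<Longrightarrow> (V i has_vector_derivative V (Suc i) t) (at t)"
      "\<And>i t. \<tau> \<le> t \<Longrightarrow> cmod (V i t) \<le> D * (e2 + e3) * (B * M ^ i * fact i powr s)"
      using gevrey[OF ab] by metis
    \<comment> \<open>\<open>Y\<close>, \<open>Z\<close> and \<open>V\<close> come from unrelated choices; uniqueness of iterated derivatives links them.\<close>
    have VYZ: "V i t = Y i t - Z i t" for i
    proof -
      have V0: "V 0 u = Y 0 u - Z 0 u" if "\<tau> \<le> u" for u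
        unfolding Y(1) Z(1) V(1)
        by (rule stepped_power_series_diff[OF a b \<open>0 < R'\<close> r(1) that])
      have "nth_deriv_on {\<tau>..T} i (V 0) t = V i t"
        by (rule nth[of V, OF V(2) _ t]) auto
      moreover have "nth_deriv_on {\<tau>..T} i (V 0) t = Y i t - Z i t"
        by (rule nth[where Y = "\<lambda>i t. Y i t - Z i t" and f = "V 0", OF _ V0 t])
           (auto intro!: has_vector_derivative_diff Y Z)
      ultimately show ?thesis by simp
    qed
    have dY: "nth_deriv_on {\<tau>..T} i (flat_output \<tau> s R' f) t = Y i t" for i
      by (rule nth[of Y, OF Y(2) _ t])
         (auto simp: Y(1) a_def flat_output_eq_stepped_power_series[OF \<open>0 < R'\<close>])
    have dZ: "nth_deriv_on {\<tau>..T} i (flat_output_trunc \<tau> s R' K N f) t = Z i t" for i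
      by (rule nth[of Z, OF Z(2) _ t])
         (auto simp: Z(1) b_def flat_output_trunc_eq_stepped_power_series)
    have weight: "cmod ((x ^ (2 * i) / fact (2 * i)) *\<^sub>R v) \<le> E * B * w i"
      if "cmod v \<le> E * (B * M ^ i * fact i powr s)" for E v i
    proof -
      have "cmod ((x ^ (2 * i) / fact (2 * i)) *\<^sub>R v) = x ^ (2 * i) / fact (2 * i) * cmod v"
        using x by simp
      also have "\<dots> \<le> 1 / fact (2 * i) * (E * (B * M ^ i * fact i powr s))"
        using x that by (intro mult_mono divide_right_mono power_le_one) auto
      finally show ?thesis by (simp add: w_def mult_ac)
    qed
    have "cmod (theta T \<tau> s R' f t x - theta_trunc T \<tau> s R' I K N f t x)
        \<le> D * (e2 + e3) * B * suminf w + D * B * (\<Sum>i. w (i + Suc I))"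
      unfolding theta_def theta_trunc_def dY dZ
    proof (rule series_truncation_error[OF w])
      show "cmod ((x ^ (2 * i) / fact (2 * i)) *\<^sub>R Y i t) \<le> D * B * w i" for i
        using t by (intro weight Y(3)) auto
      show "cmod ((x ^ (2 * i) / fact (2 * i)) *\<^sub>R Y i t - (x ^ (2 * i) / fact (2 * i)) *\<^sub>R Z i t)
          \<le> D * (e2 + e3) * B * w i" for i
        unfolding scaleR_diff_right[symmetric] VYZ[symmetric]
        using t by (intro weight V(3)) auto
    qed (use D e BM in auto)
    also have "\<dots> \<le> D * (e2 + e3) * B * suminf w + D * B * (W * e1)"
      using W(2)[of I] D BM by (intro add_left_mono mult_left_mono) (auto simp: e1_def)
    also have "\<dots> \<le> D * B * (suminf w + W) * (e1 + e2 + e3)"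
    proof -
      have "0 \<le> D * B * (suminf w * e1 + W * (e2 + e3))"
        using D BM e W(1) suminf_nonneg[OF w] by (intro mult_nonneg_nonneg add_nonneg_nonneg) auto
      then show ?thesis by (simp add: algebra_simps)
    qed
    finally show ?thesis
      by (simp add: D_def e1_def e2_def e3_def mult_ac)
  qed
  show ?thesis
  proof (intro exI conjI ballI allI)
    show "A * B * (suminf w + W) > 0"
      using A BM W(1) suminf_nonneg[OF w] by (intro mult_pos_pos add_nonneg_pos) auto
    show "(2 - s) / 2 > 0" "- ln q > 0" "\<beta> > 0" using pos q A by auto
    fix f I K N t
    assume "f \<in> L2_01" "t \<in> {\<tau>..T}"
    from norm_Linf_01_le[OF measurable_theta_diff bound[OF this]]
    show "norm_Linf_01 (\<lambda>x. theta T \<tau> s R' f t x - theta_trunc T \<tau> s R' I K N f t x)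
        \<le> ereal (A * B * (suminf w + W) * (exp (- ((2 - s) / 2) * real I * ln (real I)) + exp (- (- ln q) * real K)
                      + exp (- \<beta> * (real N)\<^sup>2)) * norm_L2_01 f)" .
  qed
qed

end
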